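(* Let $\langle\mathbb A,\sigma\restriction\mathbb A\rangle$ and $\langle\mathbb B,\sigma\restriction\mathbb B\rangle$ be elementary substructures of $\langle\mathcal P(\omega)/\mathrm{Fin},\sigma\rangle$, and let $\langle\mathbb C,\sigma^{-1}\restriction\mathbb C\rangle$ be an elementary substructure of $\langle\mathcal P(\omega)/\mathrm{Fin},\sigma^{-1}\rangle$. Then: (i) every embedding of $\langle\mathbb A,\sigma\restriction\mathbb A\rangle$ into $\langle\mathbb B,\sigma\restriction\mathbb B\rangle$ is an elementary embedding; (ii) every embedding of $\langle\mathbb A,\sigma\restriction\mathbb A\rangle$ into $\langle\mathcal P(\omega)/\mathrm{Fin},\sigma^{-1}\rangle$ is an elementary embedding; (iii) every embedding of $\langle\mathbb C,\sigma^{-1}\restriction\mathbb C\rangle$ into $\langle\mathcal P(\omega)/\mathrm{Fin},\sigma\rangle$ is an elementary embedding.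
   Context: $\mathcal P(\omega)/\mathrm{Fin}$ is $\mathcal P(\omega)$ modulo finite sets, $\sigma([A])=[A+1]$. An embedding of dynamical systems $\langle\mathbb A,\alpha\rangle\to\langle\mathbb B,\beta\rangle$ is an injective Boolean homomorphism $\eta$ with $\eta\circ\alpha=\beta\circ\eta$; it is elementary if it preserves the truth value of all first-order formulas with parameters, in the language with constants $\mathbf 0,\mathbf 1$, Boolean operations, $\le$, and unary function symbols for the automorphism and its inverse. An elementary substructure is a subalgebra closed under the automorphism and its inverse whose inclusion is an elementary embedding. No hypothesis beyond ZFC. *)

theory Defs imports Main begin

definition eq_fin :: "nat set \<Rightarrow> nat set \<Rightarrow> bool" where
  "eq_fin X Y \<longleftrightarrow> finite ((X - Y) \<union> (Y - X))"

quotient_type pow_fin = "nat set" / eq_fin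
proof (rule equivpI)
  show "reflp eq_fin" by (simp add: reflp_def eq_fin_def)
  show "symp eq_fin" by (simp add: symp_def eq_fin_def conj_commute)
  show "transp eq_fin"
  proof (rule transpI)
    fix X Y Z assume "eq_fin X Y" "eq_fin Y Z"
    then have "finite ((X - Y) \<union> (Y - X) \<union> (Y - Z) \<union> (Z - Y))"
      by (simp add: eq_fin_def)
    then show "eq_fin X Z" unfolding eq_fin_def by (rule rev_finite_subset) blast
  qed
qed

lemma eq_fin_subset:
  assumes "eq_fin X X'" "eq_fin Y Y'"
    and "(U - V) \<union> (V - U) \<subseteq> (X - X') \<union> (X' - X) \<union> (Y - Y') \<union> (Y' - Y)"
  shows "eq_fin U V"
proof -
  have "finite ((X - X') \<union> (X' - X) \<union> (Y - Y') \<union> (Y' - Y))"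
    using assms(1,2) by (simp add: eq_fin_def)
  then show ?thesis unfolding eq_fin_def using assms(3) by (rule rev_finite_subset)
qed

lemma eq_fin_almost_subset:
  assumes "eq_fin X X'" "eq_fin Y Y'" "finite (X - Y)"
  shows "finite (X' - Y')"
proof -
  have "finite ((X - X') \<union> (X' - X) \<union> (Y - Y') \<union> (Y' - Y) \<union> (X - Y))"
    using assms by (simp add: eq_fin_def)
  then show ?thesis by (rule rev_finite_subset) blast
qed

lemma eq_fin_sym: "eq_fin X Y \<Longrightarrow> eq_fin Y X"
  by (simp add: eq_fin_def conj_commute)

instantiation pow_fin :: boolean_algebra
begin

lift_definition bot_pow_fin :: pow_fin is "{}" .
lift_definition top_pow_fin :: pow_fin is "UNIV" .
lift_definition inf_pow_fin :: "pow_fin \<Rightarrow> pow_fin \<Rightarrow> pow_fin" is "(\<inter>)"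
  by (erule (1) eq_fin_subset) blast
lift_definition sup_pow_fin :: "pow_fin \<Rightarrow> pow_fin \<Rightarrow> pow_fin" is "(\<union>)"
  by (erule (1) eq_fin_subset) blast
lift_definition minus_pow_fin :: "pow_fin \<Rightarrow> pow_fin \<Rightarrow> pow_fin" is "(-)"
  by (erule (1) eq_fin_subset) blast
lift_definition uminus_pow_fin :: "pow_fin \<Rightarrow> pow_fin" is "uminus"
  by (rule eq_fin_subset, assumption, assumption, blast)
lift_definition less_eq_pow_fin :: "pow_fin \<Rightarrow> pow_fin \<Rightarrow> bool" is "\<lambda>X Y. finite (X - Y)"
  by (blast intro: eq_fin_almost_subset eq_fin_sym)
definition less_pow_fin :: "pow_fin \<Rightarrow> pow_fin \<Rightarrow> bool" where
  "less_pow_fin x y \<longleftrightarrow> x \<le> y \<and> \<not> y \<le> x"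

instance
proof
  fix x y z :: pow_fin
  show "x < y \<longleftrightarrow> x \<le> y \<and> \<not> y \<le> x" by (rule less_pow_fin_def)
  show "x \<le> x" by transfer simp
  show "x \<le> z" if "x \<le> y" "y \<le> z"
    using that
  proof transfer
    fix X Y Z :: "nat set" assume "finite (X - Y)" "finite (Y - Z)"
    then have "finite ((X - Y) \<union> (Y - Z))" by simp
    then show "finite (X - Z)" by (rule rev_finite_subset) blast
  qed
  show "x = y" if "x \<le> y" "y \<le> x" using that by transfer (simp add: eq_fin_def)
  show "inf x y \<le> x" by transfer (rule finite_subset[of _ "{}"], blast, simp)
  show "inf x y \<le> y" by transfer (rule finite_subset[of _ "{}"], blast, simp)
  show "x \<le> inf y z" if "x \<le> y" "x \<le> z" using that by transfer (simp add: Diff_Int)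
  show "x \<le> sup x y" by transfer (rule finite_subset[of _ "{}"], blast, simp)
  show "y \<le> sup x y" by transfer (rule finite_subset[of _ "{}"], blast, simp)
  show "sup y z \<le> x" if "y \<le> x" "z \<le> x" using that by transfer (simp add: Un_Diff)
  show "bot \<le> x" by transfer simp
  show "x \<le> top" by transfer simp
  show "sup x (inf y z) = inf (sup x y) (sup x z)"
    by transfer (unfold eq_fin_def, rule finite_subset[of _ "{}"], blast, simp)
  show "inf x (- x) = bot" by transfer (simp add: eq_fin_def)
  show "sup x (- x) = top" by transfer (simp add: eq_fin_def)
  show "x - y = inf x (- y)"
    by transfer (unfold eq_fin_def, rule finite_subset[of _ "{}"], blast, simp)
qed

end

lift_definition \<sigma> :: "pow_fin \<Rightarrow> pow_fin" is "\<lambda>X. Suc ` X"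
proof -
  fix X Y assume "eq_fin X Y"
  then have "finite (Suc ` ((X - Y) \<union> (Y - X)))" by (simp add: eq_fin_def)
  then show "eq_fin (Suc ` X) (Suc ` Y)"
    unfolding eq_fin_def by (rule rev_finite_subset) blast
qed

definition subalgebra :: "'a::boolean_algebra set \<Rightarrow> bool" where
  "subalgebra A \<longleftrightarrow> bot \<in> A \<and> top \<in> A \<and>
     (\<forall>x\<in>A. - x \<in> A) \<and> (\<forall>x\<in>A. \<forall>y\<in>A. inf x y \<in> A \<and> sup x y \<in> A)"

definition boolean_hom :: "'a::boolean_algebra set \<Rightarrow> 'b::boolean_algebra set \<Rightarrow> ('a \<Rightarrow> 'b) \<Rightarrow> bool" where
  "boolean_hom A B h \<longleftrightarrow> h ` A \<subseteq> B \<and> h bot = bot \<and> h top = top \<and>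
     (\<forall>x\<in>A. h (- x) = - h x) \<and>
     (\<forall>x\<in>A. \<forall>y\<in>A. h (inf x y) = inf (h x) (h y) \<and> h (sup x y) = sup (h x) (h y))"

text \<open>A dynamical system is given by a subalgebra \<open>A\<close> of an ambient Boolean algebra and a
  function \<open>\<alpha>\<close> of which only the values on \<open>A\<close> matter. In particular the pair \<open>A\<close>, \<open>\<sigma>\<close>
  represents the system with automorphism \<open>\<sigma> \<restriction> A\<close>, and the inverse of that
  automorphism is \<^term>\<open>inv_into A \<sigma>\<close>.\<close>

definition dyn_system :: "'a::boolean_algebra set \<Rightarrow> ('a \<Rightarrow> 'a) \<Rightarrow> bool" where
  "dyn_system A \<alpha> \<longleftrightarrow> subalgebra A \<and> boolean_hom A A \<alpha> \<and> bij_betw \<alpha> A A"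

definition dyn_embedding ::
  "'a::boolean_algebra set \<Rightarrow> ('a \<Rightarrow> 'a) \<Rightarrow> 'b::boolean_algebra set \<Rightarrow> ('b \<Rightarrow> 'b) \<Rightarrow> ('a \<Rightarrow> 'b) \<Rightarrow> bool"
  where
  "dyn_embedding A \<alpha> B \<beta> \<eta> \<longleftrightarrow> dyn_system A \<alpha> \<and> dyn_system B \<beta> \<and>
     boolean_hom A B \<eta> \<and> inj_on \<eta> A \<and> (\<forall>x\<in>A. \<eta> (\<alpha> x) = \<beta> (\<eta> x))"

datatype dyn_term =
    Var nat
  | Zero
  | One
  | Compl dyn_term
  | Meet dyn_term dyn_term
  | Join dyn_term dyn_term
  | Aut dyn_term
  | AutInv dyn_term

datatype dyn_form =
    Eq dyn_term dyn_term
  | Le dyn_term dyn_term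
  | Neg dyn_form
  | Conj dyn_form dyn_form
  | Disj dyn_form dyn_form
  | Imp dyn_form dyn_form
  | All nat dyn_form
  | Ex nat dyn_form

primrec eval_term ::
  "'a::boolean_algebra set \<Rightarrow> ('a \<Rightarrow> 'a) \<Rightarrow> (nat \<Rightarrow> 'a) \<Rightarrow> dyn_term \<Rightarrow> 'a" where
  "eval_term A \<alpha> e (Var n) = e n"
| "eval_term A \<alpha> e Zero = bot"
| "eval_term A \<alpha> e One = top"
| "eval_term A \<alpha> e (Compl t) = - eval_term A \<alpha> e t"
| "eval_term A \<alpha> e (Meet s t) = inf (eval_term A \<alpha> e s) (eval_term A \<alpha> e t)"
| "eval_term A \<alpha> e (Join s t) = sup (eval_term A \<alpha> e s) (eval_term A \<alpha> e t)"
| "eval_term A \<alpha> e (Aut t) = \<alpha> (eval_term A \<alpha> e t)"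
| "eval_term A \<alpha> e (AutInv t) = inv_into A \<alpha> (eval_term A \<alpha> e t)"

primrec sat ::
  "'a::boolean_algebra set \<Rightarrow> ('a \<Rightarrow> 'a) \<Rightarrow> (nat \<Rightarrow> 'a) \<Rightarrow> dyn_form \<Rightarrow> bool" where
  "sat A \<alpha> e (Eq s t) \<longleftrightarrow> eval_term A \<alpha> e s = eval_term A \<alpha> e t"
| "sat A \<alpha> e (Le s t) \<longleftrightarrow> eval_term A \<alpha> e s \<le> eval_term A \<alpha> e t"
| "sat A \<alpha> e (Neg \<phi>) \<longleftrightarrow> \<not> sat A \<alpha> e \<phi>"
| "sat A \<alpha> e (Conj \<phi> \<psi>) \<longleftrightarrow> sat A \<alpha> e \<phi> \<and> sat A \<alpha> e \<psi>"
| "sat A \<alpha> e (Disj \<phi> \<psi>) \<longleftrightarrow> sat A \<alpha> e \<phi> \<or> sat A \<alpha> e \<psi>"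
| "sat A \<alpha> e (Imp \<phi> \<psi>) \<longleftrightarrow> (sat A \<alpha> e \<phi> \<longrightarrow> sat A \<alpha> e \<psi>)"
| "sat A \<alpha> e (All n \<phi>) \<longleftrightarrow> (\<forall>a\<in>A. sat A \<alpha> (e(n := a)) \<phi>)"
| "sat A \<alpha> e (Ex n \<phi>) \<longleftrightarrow> (\<exists>a\<in>A. sat A \<alpha> (e(n := a)) \<phi>)"

text \<open>The parameters of a formula are the values that the assignment \<open>e\<close> gives to its free
  variables; \<open>\<eta> \<circ> e\<close> replaces each parameter by its image.\<close>

definition elementary_embedding ::
  "'a::boolean_algebra set \<Rightarrow> ('a \<Rightarrow> 'a) \<Rightarrow> 'b::boolean_algebra set \<Rightarrow> ('b \<Rightarrow> 'b) \<Rightarrow> ('a \<Rightarrow> 'b) \<Rightarrow> bool"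
  where
  "elementary_embedding A \<alpha> B \<beta> \<eta> \<longleftrightarrow> dyn_embedding A \<alpha> B \<beta> \<eta> \<and>
     (\<forall>\<phi> e. range e \<subseteq> A \<longrightarrow> (sat A \<alpha> e \<phi> \<longleftrightarrow> sat B \<beta> (\<eta> \<circ> e) \<phi>))"

definition elementary_substructure ::
  "'a::boolean_algebra set \<Rightarrow> 'a set \<Rightarrow> ('a \<Rightarrow> 'a) \<Rightarrow> bool" where
  "elementary_substructure A B \<beta> \<longleftrightarrow> A \<subseteq> B \<and> subalgebra A \<and>
     \<beta> ` A \<subseteq> A \<and> inv_into B \<beta> ` A \<subseteq> A \<and> elementary_embedding A \<beta> B \<beta> id"

lemma eq_finI: "(\<And>n::nat. n \<noteq> 0 \<Longrightarrow> n \<in> X \<longleftrightarrow> n \<in> Y) \<Longrightarrow> eq_fin X Y"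
proof -
  assume *: "\<And>n. n \<noteq> 0 \<Longrightarrow> n \<in> X \<longleftrightarrow> n \<in> Y"
  have "(X - Y) \<union> (Y - X) \<subseteq> {0}" using * by blast
  then show "eq_fin X Y" unfolding eq_fin_def by (rule finite_subset) simp
qed

lemma dyn_system_\<sigma>: "dyn_system UNIV \<sigma>"
proof -
  have "\<exists>x. \<sigma> x = y" for y
  proof transfer
    fix Y :: "nat set"
    have "eq_fin (Suc ` {n. Suc n \<in> Y}) Y"
      by (rule eq_finI) (metis (mono_tags, lifting) image_iff mem_Collect_eq not0_implies_Suc)
    then show "\<exists>X. eq_fin (Suc ` X) Y" by blast
  qed
  then have "surj \<sigma>" by (metis surjI)
  moreover have "inj \<sigma>"
  proof (rule injI)
    show "x = y" if "\<sigma> x = \<sigma> y" for x y using that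
    proof transfer
      fix X Y assume "eq_fin (Suc ` X) (Suc ` Y)"
      moreover have "(Suc ` X - Suc ` Y) \<union> (Suc ` Y - Suc ` X) = Suc ` ((X - Y) \<union> (Y - X))"
        by blast
      ultimately have "finite (Suc ` ((X - Y) \<union> (Y - X)))" by (simp only: eq_fin_def)
      then show "eq_fin X Y"
        unfolding eq_fin_def by (rule finite_imageD) simp
    qed
  qed
  moreover have "boolean_hom UNIV UNIV \<sigma>"
  proof -
    have "\<sigma> bot = bot" by transfer (simp add: eq_fin_def)
    moreover have "\<sigma> top = top"
      by transfer (rule eq_finI, metis UNIV_I image_eqI not0_implies_Suc)
    moreover have "\<sigma> (- x) = - \<sigma> x" for x
      by transfer (rule eq_finI, metis Compl_iff image_iff inj_image_mem_iff inj_Suc not0_implies_Suc)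
    moreover have "\<sigma> (inf x y) = inf (\<sigma> x) (\<sigma> y)" for x y
      by transfer (rule eq_finI, blast)
    moreover have "\<sigma> (sup x y) = sup (\<sigma> x) (\<sigma> y)" for x y
      by transfer (rule eq_finI, blast)
    ultimately show ?thesis by (simp add: boolean_hom_def)
  qed
  ultimately show ?thesis by (simp add: dyn_system_def subalgebra_def bij_betw_def)
qed

end

theory Submission imports Defs "HOL-Library.Ramsey" begin

text \<open>This is Buechi's argument for the monadic second-order theory of \<open>\<omega>\<close>. An assignment into
  \<open>\<P>(\<omega>)/Fin\<close> is a word \<open>w\<close> over sets of variables, known up to finite changes. For every formula
  there is a congruence \<open>h\<close> of finite index on finite words such that the truth value depends only
  on the value \<open>c\<close> for which some infinite \<open>X\<close> cuts \<open>w\<close> into blocks that all have \<open>h\<close>-value \<open>c\<close>;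
  such an \<open>X\<close> exists by Ramsey's theorem. For \<open>\<sigma>\<close> blocks are read upwards, for the inverse of \<open>\<sigma>\<close>
  downwards, and the dependence of the truth value on \<open>c\<close> is the same in both directions. The
  existence of \<open>X\<close> is expressed by an existential formula, whose matrix any embedding preserves.\<close>

subsection \<open>Finite congruences on words\<close>

text \<open>The flag \<open>d\<close> is the reading direction, true for \<open>\<sigma>\<close> and false for its inverse. The backward
  block excludes \<open>m\<close> and includes \<open>n\<close>, so that in both directions a block starts at a cut point
  and stops just before the next one.\<close>

definition block :: "bool \<Rightarrow> (nat \<Rightarrow> 'l) \<Rightarrow> nat \<Rightarrow> nat \<Rightarrow> 'l list" where
  "block d w m n = map w (if d then [m..<n] else rev [Suc m..<Suc n])"

definition in_block :: "bool \<Rightarrow> nat \<Rightarrow> nat \<Rightarrow> nat \<Rightarrow> bool" where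
  "in_block d m n k \<longleftrightarrow> (if d then m \<le> k \<and> k < n else m < k \<and> k \<le> n)"

text \<open>Restricted to nonempty words because the value used for local conditions records first
  and last letters.\<close>

definition congruence :: "('l list \<Rightarrow> 's) \<Rightarrow> bool" where
  "congruence h \<longleftrightarrow> (\<forall>u u' v v'. u \<noteq> [] \<longrightarrow> u' \<noteq> [] \<longrightarrow> v \<noteq> [] \<longrightarrow> v' \<noteq> [] \<longrightarrow>
     h u = h u' \<longrightarrow> h v = h v' \<longrightarrow> h (u @ v) = h (u' @ v'))"

text \<open>A Ramseyan factorization: every concatenation of consecutive blocks, not only each
  single block, has value \<open>c\<close>.\<close>

definition homog :: "bool \<Rightarrow> ('l list \<Rightarrow> 's) \<Rightarrow> (nat \<Rightarrow> 'l) \<Rightarrow> nat set \<Rightarrow> 's \<Rightarrow> bool" where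
  "homog d h w X c \<longleftrightarrow> infinite X \<and> (\<forall>m\<in>X. \<forall>n\<in>X. m < n \<longrightarrow> h (block d w m n) = c)"

definition idem_value :: "('l list \<Rightarrow> 's) \<Rightarrow> 's \<Rightarrow> bool" where
  "idem_value h c \<longleftrightarrow> (\<forall>u v. u \<noteq> [] \<longrightarrow> v \<noteq> [] \<longrightarrow> h u = c \<longrightarrow> h v = c \<longrightarrow> h (u @ v) = c)"

definition consec :: "nat set \<Rightarrow> nat \<Rightarrow> nat \<Rightarrow> bool" where
  "consec X m n \<longleftrightarrow> m \<in> X \<and> n \<in> X \<and> m < n \<and> (\<forall>x\<in>X. \<not> (m < x \<and> x < n))"

definition recognizes :: "('l list \<Rightarrow> 's) \<Rightarrow> (bool \<Rightarrow> (nat \<Rightarrow> 'l) \<Rightarrow> bool) \<Rightarrow> bool" where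
  "recognizes h R \<longleftrightarrow> finite (range h) \<and> congruence h \<and>
     (\<forall>d d' w w' X X' c. homog d h w X c \<longrightarrow> homog d' h w' X' c \<longrightarrow> R d w \<longrightarrow> R d' w')"

definition recognizable :: "(bool \<Rightarrow> (nat \<Rightarrow> 'l) \<Rightarrow> bool) \<Rightarrow> bool" where
  "recognizable R \<longleftrightarrow> (\<exists>h :: 'l list \<Rightarrow> nat. recognizes h R)"

lemma congruenceD:
  "congruence h \<Longrightarrow> u \<noteq> [] \<Longrightarrow> u' \<noteq> [] \<Longrightarrow> v \<noteq> [] \<Longrightarrow> v' \<noteq> [] \<Longrightarrow>
    h u = h u' \<Longrightarrow> h v = h v' \<Longrightarrow> h (u @ v) = h (u' @ v')"
  unfolding congruence_def by blast

lemma recognizesI: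
  assumes "finite (range h)" "congruence h"
    and "\<And>d d' w w' X X' c. homog d h w X c \<Longrightarrow> homog d' h w' X' c \<Longrightarrow> R d w \<Longrightarrow> R d' w'"
  shows "recognizes h R"
  unfolding recognizes_def using assms(1,2) by (auto dest: assms(3))

lemma recognizesD:
  assumes "recognizes h R"
  shows "finite (range h)" "congruence h"
    "homog d h w X c \<Longrightarrow> homog d' h w' X' c \<Longrightarrow> R d w \<Longrightarrow> R d' w'"
  using assms unfolding recognizes_def by blast+

lemma block_nonempty [simp]: "block d w m n \<noteq> [] \<longleftrightarrow> m < n"
  by (auto simp: block_def)

lemma block_append:
  assumes "m \<le> n" "n \<le> p"
  shows "block d w m p = (if d then block d w m n @ block d w n p else block d w n p @ block d w m n)"
proof -
  have "[m..<p] = [m..<n] @ [n..<p]" "[Suc m..<Suc p] = [Suc m..<Suc n] @ [Suc n..<Suc p]"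
    using assms upt_add_eq_append[of m n "p - n"]
      upt_add_eq_append[of "Suc m" "Suc n" "p - n"] by auto
  then show ?thesis by (simp add: block_def del: upt_Suc)
qed

lemma block_cong:
  "(\<And>k. in_block d m n k \<Longrightarrow> w k = w' k) \<Longrightarrow> block d w m n = block d w' m n"
  by (auto simp: block_def in_block_def simp del: upt_Suc)

text \<open>Three cut points suffice: the block from the first to the third is the concatenation, in
  one order or the other, of two blocks of value \<open>c\<close>, and the congruence carries this
  equation to all nonempty words of value \<open>c\<close>.\<close>

lemma homog_idem:
  assumes "congruence h" "homog d h w X c"
  shows "idem_value h c"
proof -
  from assms(2) have inf: "infinite X"
    and X: "\<And>m n. m \<in> X \<Longrightarrow> n \<in> X \<Longrightarrow> m < n \<Longrightarrow> h (block d w m n) = c"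
    by (auto simp: homog_def)
  obtain m where m: "m \<in> X" using inf by (meson infinite_nat_iff_unbounded)
  obtain n where n: "n \<in> X" "m < n" using inf by (meson infinite_nat_iff_unbounded)
  obtain p where p: "p \<in> X" "n < p" using inf by (meson infinite_nat_iff_unbounded)
  have "h (block d w m p) = c" using X m n p by simp
  then have *: "h (block d w m n @ block d w n p) = c \<or> h (block d w n p @ block d w m n) = c"
    using block_append[of m n p d w] n p by (auto split: if_splits)
  show ?thesis unfolding idem_value_def
    using * congruenceD[OF assms(1)] X[OF m n] X[OF n(1) p] n(2) p(2)
    by (metis block_nonempty)
qed

text \<open>A long block is split at the last cut point before its right end; idempotence keeps the
  value \<open>c\<close> at the seam.\<close>

lemma homog_of_consec:
  assumes "infinite X" "idem_value h c"
    and "\<And>m n. consec X m n \<Longrightarrow> h (block d w m n) = c"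
  shows "homog d h w X c"
proof -
  have "m \<in> X \<Longrightarrow> n \<in> X \<Longrightarrow> m < n \<Longrightarrow> h (block d w m n) = c" for m n
  proof (induction n rule: less_induct)
    case (less n)
    define p where "p = Max {x \<in> X. x < n}"
    have fin: "finite {x \<in> X. x < n}" by simp
    have p: "p \<in> X" "p < n" using Max_in[OF fin] less.prems unfolding p_def by blast+
    have mp: "m \<le> p" and "\<And>x. x \<in> X \<Longrightarrow> x < n \<Longrightarrow> x \<le> p"
      using less.prems fin unfolding p_def by auto
    then have "consec X p n" using p less.prems by (force simp: consec_def)
    then have pn: "h (block d w p n) = c" by (rule assms(3))
    show ?case
    proof (cases "m = p")
      case False
      then have "m < p" using mp by simp
      then have "h (block d w m p) = c" using less p by blast
      then show ?thesis using pn \<open>m < p\<close> p assms(2) block_append[of m p n d w]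
        by (cases d) (simp_all add: idem_value_def)
    qed (use pn in simp)
  qed
  then show ?thesis using assms(1) by (simp add: homog_def)
qed

lemma homog_exists:
  fixes h :: "'l list \<Rightarrow> 's"
  assumes "finite (range h)" "infinite Z"
  obtains Y c where "Y \<subseteq> Z" "homog d h w Y c"
proof -
  obtain g :: "'s \<Rightarrow> nat" and N where g: "g ` range h = {i. i < N}" "inj_on g (range h)"
    using finite_imp_inj_to_nat_seg[OF assms(1)] by blast
  let ?f = "\<lambda>S. g (h (block d w (Min S) (Max S)))"
  have lt: "g (h v) < N" for v using g(1) by blast
  obtain Y t where Y: "Y \<subseteq> Z" "infinite Y" "\<forall>x\<in>Y. \<forall>y\<in>Y. x \<noteq> y \<longrightarrow> ?f {x, y} = t"
    using Ramsey2[OF assms(2), of ?f N] lt by blast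
  have gt: "g (h (block d w m n)) = t" if "m \<in> Y" "n \<in> Y" "m < n" for m n
    using Y(3) that by (force simp: min_def max_def)
  obtain m where m: "m \<in> Y" using Y(2) by (meson infinite_nat_iff_unbounded)
  obtain n where n: "n \<in> Y" "m < n" using Y(2) by (meson infinite_nat_iff_unbounded)
  have "homog d h w Y (h (block d w m n))"
    unfolding homog_def
  proof (intro conjI ballI impI)
    fix a b assume "a \<in> Y" "b \<in> Y" "a < b"
    then have "g (h (block d w a b)) = g (h (block d w m n))" using gt m n by simp
    then show "h (block d w a b) = h (block d w m n)" by (rule inj_onD[OF g(2)]) simp_all
  qed (rule Y(2))
  then show ?thesis using that Y(1) by blast
qed

lemma homog_in_range:
  assumes "homog d h w X c"
  shows "c \<in> range h"
proof -
  have inf: "infinite X" using assms by (simp add: homog_def)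
  obtain m where m: "m \<in> X" using inf by (meson infinite_nat_iff_unbounded)
  obtain n where n: "n \<in> X" "m < n" using inf by (meson infinite_nat_iff_unbounded)
  have "h (block d w m n) = c" using assms m n by (simp add: homog_def)
  then show ?thesis by blast
qed

section \<open>Closure properties of recognizable relations\<close>

text \<open>Renumbering the values is harmless: the value of a homogeneous set lies in
  \<open>range h\<close>, where \<open>g\<close> is injective.\<close>

lemma recognizableI:
  fixes h :: "'l list \<Rightarrow> 's"
  assumes "recognizes h R"
  shows "recognizable R"
proof -
  have fin: "finite (range h)" using assms by (simp add: recognizes_def)
  obtain g :: "'s \<Rightarrow> nat" where g: "inj_on g (range h)"
    using finite_imp_inj_to_nat_seg[OF fin] by (elim exE conjE)
  then have eq: "g (h u) = g (h v) \<longleftrightarrow> h u = h v" for u v by (auto dest: inj_onD)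
  have ex: "\<exists>c'. c = g c' \<and> homog d h w X c'"
    if "homog d (g \<circ> h) w X c" for d c X and w :: "nat \<Rightarrow> 'l"
  proof -
    from that have inf: "infinite X"
      and X: "\<And>m n. m \<in> X \<Longrightarrow> n \<in> X \<Longrightarrow> m < n \<Longrightarrow> g (h (block d w m n)) = c"
      by (auto simp: homog_def)
    obtain m where m: "m \<in> X" using inf by (meson infinite_nat_iff_unbounded)
    obtain n where n: "n \<in> X" "m < n" using inf by (meson infinite_nat_iff_unbounded)
    show ?thesis
      using inf X[OF m n] X eq by (intro exI[of _ "h (block d w m n)"]) (auto simp: homog_def)
  qed
  have "finite (range (g \<circ> h))" using fin by (metis finite_imageI image_comp)
  moreover have "congruence (g \<circ> h)"
  proof -
    have "congruence h" using assms by (simp add: recognizes_def)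
    then show ?thesis unfolding congruence_def o_apply eq .
  qed
  moreover have "R d' w'" if hom: "homog d (g \<circ> h) w X c" "homog d' (g \<circ> h) w' X' c" and "R d w"
    for d d' w w' X X' c
  proof -
    obtain a where a: "c = g a" "homog d h w X a" using ex[OF hom(1)] by (elim exE conjE)
    obtain b where b: "c = g b" "homog d' h w' X' b" using ex[OF hom(2)] by (elim exE conjE)
    have "g a = g b" using a(1) b(1) by simp
    then have "a = b" by (rule inj_onD[OF g]) (rule homog_in_range, rule a b)+
    then show ?thesis using recognizesD(3)[OF assms a(2)] b(2) \<open>R d w\<close> by simp
  qed
  ultimately have "recognizes (g \<circ> h) R" by (rule recognizesI)
  then show ?thesis unfolding recognizable_def by blast
qed

text \<open>Exchanging the two words in \<open>recognizes\<close> turns its implication into an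
  equivalence, which survives negation.\<close>

lemma recognizable_not:
  "recognizable R \<Longrightarrow> recognizable (\<lambda>d w. \<not> R d w)"
  unfolding recognizable_def recognizes_def by blast

lemma recognizable_conj:
  assumes "recognizable R" "recognizable S"
  shows "recognizable (\<lambda>d w. R d w \<and> S d w)"
proof -
  obtain g h :: "'a list \<Rightarrow> nat" where g: "recognizes g R" and h: "recognizes h S"
    using assms by (auto simp: recognizable_def)
  let ?p = "\<lambda>u. (g u, h u)"
  have "range ?p \<subseteq> range g \<times> range h" by auto
  then have "finite (range ?p)"
    by (rule finite_subset) (use g h in \<open>simp add: recognizes_def\<close>)
  moreover have "congruence ?p"
  proof -
    have "congruence g" "congruence h" using g h by (simp_all add: recognizes_def)
    then show ?thesis
      unfolding congruence_def[of ?p] prod.inject by (intro allI impI conjI) (metis congruenceD)+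
  qed
  moreover have "R d' w' \<and> S d' w'"
    if "homog d ?p w X c" "homog d' ?p w' X' c" "R d w \<and> S d w" for d d' w w' X X' c
  proof -
    have "homog d g w X (fst c)" "homog d h w X (snd c)"
      "homog d' g w' X' (fst c)" "homog d' h w' X' (snd c)"
      using that(1,2) by (cases c; simp add: homog_def)+
    then show ?thesis using g h that(3) unfolding recognizes_def by blast
  qed
  ultimately have "recognizes ?p (\<lambda>d w. R d w \<and> S d w)"
    by (rule recognizesI)
  then show ?thesis by (rule recognizableI)
qed

text \<open>Totality of \<rho> supplies letters outside the block, so a variant of a block always
  extends to a variant of the whole word.\<close>

lemma block_variant:
  assumes "\<And>a. \<exists>b. \<rho> a b"
  shows "list_all2 \<rho> (block d w m n) v \<longleftrightarrow> (\<exists>w'. (\<forall>k. \<rho> (w k) (w' k)) \<and> v = block d w' m n)"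
proof
  assume L: "list_all2 \<rho> (block d w m n) v"
  obtain r where r: "\<And>a. \<rho> a (r a)" using assms by metis
  \<comment> \<open>Position \<open>k\<close> has index \<open>k - m\<close> in a forward block and
    \<open>n - k\<close> in a backward one, which starts at \<open>n\<close>.\<close>
  define w' where "w' k = (if in_block d m n k
    then v ! (if d then k - m else n - k) else r (w k))" for k
  have len: "length v = n - m" using list_all2_lengthD[OF L] by (auto simp: block_def split: if_splits)
  have nth: "block d w m n ! i = w (if d then m + i else n - i)" if "i < n - m"
    for i and w :: "nat \<Rightarrow> 'z"
    using that by (auto simp: block_def rev_nth Suc_diff_Suc simp del: upt_Suc)
  have "\<rho> (w k) (w' k)" for k
  proof (cases "in_block d m n k")
    case True
    let ?i = "if d then k - m else n - k"
    have i: "?i < n - m" "(if d then m + ?i else n - ?i) = k"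
      using True by (auto simp: in_block_def split: if_splits)
    have "\<rho> (block d w m n ! ?i) (v ! ?i)"
      using L i(1) len by (simp add: list_all2_conv_all_nth)
    then show ?thesis using True nth[OF i(1), of w] i(2) by (simp add: w'_def)
  qed (simp add: w'_def r)
  moreover have "v = block d w' m n"
  proof (rule nth_equalityI)
    show "length v = length (block d w' m n)" using len by (auto simp: block_def)
    fix i assume "i < length v"
    then have i: "i < n - m" using len by simp
    show "v ! i = block d w' m n ! i"
      unfolding nth[OF i] using i by (auto simp: w'_def in_block_def)
  qed
  ultimately show "\<exists>w'. (\<forall>k. \<rho> (w k) (w' k)) \<and> v = block d w' m n" by blast
next
  assume "\<exists>w'. (\<forall>k. \<rho> (w k) (w' k)) \<and> v = block d w' m n"
  then show "list_all2 \<rho> (block d w m n) v"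
    by (auto simp: block_def list_all2_conv_all_nth simp del: upt_Suc)
qed

text \<open>No cut point lies strictly between consecutive ones, which rules out overlap. Uniqueness
  makes the gluing in the projection well defined.\<close>

lemma consec_block_unique:
  assumes "consec X m n" "consec X m' n'" "in_block d m n k" "in_block d m' n' k"
  shows "m = m' \<and> n = n'"
proof -
  have "\<not> (m < m' \<and> m' < n)" "\<not> (m < n' \<and> n' < n)" "\<not> (m' < m \<and> m < n')" "\<not> (m' < n \<and> n < n')"
    using assms(1,2) unfolding consec_def by blast+
  moreover have "if d then m \<le> k \<and> k < n \<and> m' \<le> k \<and> k < n' else m < k \<and> k \<le> n \<and> m' < k \<and> k \<le> n'"
    using assms(3,4) by (auto simp: in_block_def)
  ultimately show ?thesis by (cases d; simp only: if_True if_False; arith)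
qed

text \<open>The congruence for the projection takes as values the sets of values of \<open>h\<close> on the variants
  of a word. Conversely, variants of the single blocks with a common idempotent value are glued.\<close>

lemma recognizable_project:
  assumes tot: "\<And>a. \<exists>b. \<rho> a b" and "recognizable R"
  shows "recognizable (\<lambda>d w. \<exists>w'. (\<forall>k. \<rho> (w k) (w' k)) \<and> R d w')"
proof -
  obtain h :: "'b list \<Rightarrow> nat" where h: "recognizes h R"
    using assms(2) by (auto simp: recognizable_def)
  then have fin: "finite (range h)" and cong: "congruence h"
    and R: "\<And>d d' w w' X X' c. homog d h w X c \<Longrightarrow> homog d' h w' X' c \<Longrightarrow> R d w \<Longrightarrow> R d' w'"
    unfolding recognizes_def by blast+
  define H where "H u = h ` {v. list_all2 \<rho> u v}" for u
  have H_block: "H (block d w m n) = {h (block d w' m n) |w'. \<forall>k. \<rho> (w k) (w' k)}" for d w m n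
    unfolding H_def using block_variant[of \<rho> d w m n, OF tot] by auto
  have "range H \<subseteq> Pow (range h)" by (auto simp: H_def)
  then have "finite (range H)" by (rule finite_subset) (simp add: fin)
  moreover have "congruence H"
    unfolding congruence_def
  proof (intro allI impI)
    have sub: "H (u @ v) \<subseteq> H (u' @ v')"
      if ne: "u \<noteq> []" "u' \<noteq> []" "v \<noteq> []" "v' \<noteq> []" and eq: "H u = H u'" "H v = H v'"
      for u u' v v'
    proof
      fix s assume "s \<in> H (u @ v)"
      then obtain x y where s: "s = h (x @ y)" and xy: "list_all2 \<rho> u x" "list_all2 \<rho> v y"
        by (auto simp: H_def list_all2_append1)
      then have "h x \<in> H u'" "h y \<in> H v'" unfolding eq[symmetric] by (auto simp: H_def)
      then obtain x' y' where xy': "list_all2 \<rho> u' x'" "list_all2 \<rho> v' y'" "h x = h x'" "h y = h y'"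
        by (auto simp: H_def)
      then have "x \<noteq> []" "y \<noteq> []" "x' \<noteq> []" "y' \<noteq> []" using xy ne by auto
      then have "s = h (x' @ y')" using s xy' congruenceD[OF cong] by blast
      moreover have "list_all2 \<rho> (u' @ v') (x' @ y')" using xy' by (simp add: list_all2_appendI)
      ultimately show "s \<in> H (u' @ v')" by (auto simp: H_def)
    qed
    fix u u' v v'
    assume "u \<noteq> []" "u' \<noteq> []" "v \<noteq> []" "v' \<noteq> []" "H u = H u'" "H v = H v'"
    then show "H (u @ v) = H (u' @ v')" using sub[of u u' v v'] sub[of u' u v' v] by auto
  qed
  moreover have "\<exists>w2'. (\<forall>k. \<rho> (w' k) (w2' k)) \<and> R d' w2'"
    if hw: "homog d H w X c" and hw': "homog d' H w' X' c" and ex: "\<exists>w2. (\<forall>k. \<rho> (w k) (w2 k)) \<and> R d w2"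
    for d d' w w' X X' c
  proof -
    from ex obtain w2 where w2: "\<forall>k. \<rho> (w k) (w2 k)" "R d w2" by blast
    \<comment> \<open>The witness \<open>w2\<close> need not be homogeneous along \<open>X\<close>,
      so Ramsey's theorem thins \<open>X\<close> to \<open>Y\<close>; \<open>f\<close> is the value
      of \<open>h\<close> on the blocks of \<open>w2\<close>.\<close>
    obtain Y f where Y: "Y \<subseteq> X" "homog d h w2 Y f"
      using homog_exists[OF fin] hw by (metis homog_def)
    have idem: "idem_value h f" using homog_idem[OF cong Y(2)] .
    have infY: "infinite Y" using Y(2) by (simp add: homog_def)
    obtain m where m: "m \<in> Y" using infY by (meson infinite_nat_iff_unbounded)
    obtain n where n: "n \<in> Y" "m < n" using infY by (meson infinite_nat_iff_unbounded)
    have "f = h (block d w2 m n)" using Y(2) m n by (simp add: homog_def)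
    then have "f \<in> H (block d w m n)" using w2(1) H_block by blast
    then have fc: "f \<in> c" using hw m n Y(1) by (auto simp: homog_def)
    have infX': "infinite X'" using hw' by (simp add: homog_def)
    have "\<exists>v. (\<forall>k. \<rho> (w' k) (v k)) \<and> h (block d' v m n) = f" if "consec X' m n" for m n
    proof -
      have "f \<in> H (block d' w' m n)" using hw' that fc by (auto simp: homog_def consec_def)
      then show ?thesis by (auto simp: H_block)
    qed
    then obtain V where V: "\<And>m n k. consec X' m n \<Longrightarrow> \<rho> (w' k) (V m n k)"
      "\<And>m n. consec X' m n \<Longrightarrow> h (block d' (V m n) m n) = f"
      by metis
    obtain r where r: "\<And>a. \<rho> a (r a)" using tot by metis
    \<comment> \<open>\<open>P k\<close> holds of at most one pair, the consecutive cut points whose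
      block contains \<open>k\<close>; positions in no block get the default letter
      \<open>r (w' k)\<close>.\<close>
    define P where "P k p \<longleftrightarrow> consec X' (fst p) (snd p) \<and> in_block d' (fst p) (snd p) k" for k p
    define v where "v k = (if \<exists>p. P k p then V (fst (Eps (P k))) (snd (Eps (P k))) k else r (w' k))" for k
    have \<rho>v: "\<rho> (w' k) (v k)" for k
      using r V(1) someI_ex[of "P k"] by (auto simp: v_def) (metis P_def)
    have "h (block d' v m n) = f" if c: "consec X' m n" for m n
    proof -
      have "v k = V m n k" if "in_block d' m n k" for k
      proof -
        have "P k (m, n)" using c that by (simp add: P_def)
        moreover from this have "P k (Eps (P k))" by (rule someI)
        moreover from this have "fst (Eps (P k)) = m \<and> snd (Eps (P k)) = n"
          using consec_block_unique[of X' "fst (Eps (P k))" "snd (Eps (P k))" m n d' k] c that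
          unfolding P_def by blast
        ultimately show ?thesis by (auto simp: v_def)
      qed
      then have "block d' v m n = block d' (V m n) m n" by (rule block_cong)
      then show ?thesis using V(2)[OF c] by (simp only:)
    qed
    then have "homog d' h v X' f" by (rule homog_of_consec[OF infX' idem])
    then show ?thesis using R[OF Y(2)] w2(2) \<rho>v by blast
  qed
  ultimately have "recognizes H (\<lambda>d w. \<exists>w'. (\<forall>k. \<rho> (w k) (w' k)) \<and> R d w')"
    by (rule recognizesI)
  then show ?thesis by (rule recognizableI)
qed

section \<open>Conditions on adjacent letters\<close>

definition locally :: "bool \<Rightarrow> ('l \<Rightarrow> 'l \<Rightarrow> bool) \<Rightarrow> (nat \<Rightarrow> 'l) \<Rightarrow> bool" where
  "locally d Q w \<longleftrightarrow>
     (\<forall>\<^sub>F n in sequentially. if d then Q (w n) (w (Suc n)) else Q (w (Suc n)) (w n))"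

lemma successively_block:
  "successively Q (block d w m n) \<longleftrightarrow>
    (\<forall>k. in_block d m n k \<and> in_block d m n (Suc k) \<longrightarrow>
      (if d then Q (w k) (w (Suc k)) else Q (w (Suc k)) (w k)))"
proof -
  have upt: "successively P (map w [i..<j]) \<longleftrightarrow> (\<forall>k. i \<le> k \<and> Suc k < j \<longrightarrow> P (w k) (w (Suc k)))"
    for P and i j :: nat
  proof (induction j)
    case (Suc j)
    show ?case
    proof (cases "i < j")
      case True
      then have "successively P (map w [i..<Suc j]) \<longleftrightarrow>
          successively P (map w [i..<j]) \<and> P (w (j - 1)) (w j)"
        by (auto simp: successively_append_iff last_map)
      also have "\<dots> \<longleftrightarrow> (\<forall>k. i \<le> k \<and> Suc k < Suc j \<longrightarrow> P (w k) (w (Suc k)))"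
      proof -
        obtain j' where "j = Suc j'" using True by (cases j) auto
        then show ?thesis unfolding Suc using True by (auto simp: less_Suc_eq)
      qed
      finally show ?thesis .
    next
      case False
      then show ?thesis by (cases "i = j") auto
    qed
  qed simp
  show ?thesis
    by (cases d) (auto simp: block_def in_block_def rev_map[symmetric] upt Suc_le_eq less_Suc_eq_le
      simp del: upt_Suc)
qed

text \<open>First letter, last letter and inner validity determine those of a concatenation, since
  only the pair at the seam is new. Cutting letters down to \<open>V\<close> keeps the number of
  values finite.\<close>

lemma recognizable_locally:
  fixes Q :: "'v set \<Rightarrow> 'v set \<Rightarrow> bool"
  assumes "finite V" and Q: "\<And>a b. Q a b \<longleftrightarrow> Q (a \<inter> V) (b \<inter> V)"
  shows "recognizable (\<lambda>d. locally d Q)"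
proof -
  define h where "h v = (hd v \<inter> V, last v \<inter> V, successively Q v)" for v
  have "range h \<subseteq> Pow V \<times> Pow V \<times> UNIV" by (auto simp: h_def)
  then have "finite (range h)" by (rule finite_subset) (simp add: assms(1))
  moreover have "congruence h"
    unfolding congruence_def
  proof (intro allI impI)
    fix u u' v v'
    assume "u \<noteq> []" "u' \<noteq> []" "v \<noteq> []" "v' \<noteq> []" "h u = h u'" "h v = h v'"
    then show "h (u @ v) = h (u' @ v')"
      unfolding h_def using Q[of "last u" "hd v"] Q[of "last u'" "hd v'"]
      by (simp add: successively_append_iff)
  qed
  moreover have "locally d Q w \<longleftrightarrow> snd (snd c)" if "homog d h w X c" for d w X c
  proof -
    from that have inf: "infinite X"
      and "\<And>m n. m \<in> X \<Longrightarrow> n \<in> X \<Longrightarrow> m < n \<Longrightarrow> h (block d w m n) = c"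
      by (auto simp: homog_def)
    then have X: "successively Q (block d w m n) = snd (snd c)" if "m \<in> X" "n \<in> X" "m < n" for m n
      using that by (metis h_def snd_conv)
    show ?thesis
    proof
      assume "locally d Q w"
      then obtain k where k: "\<And>n. n \<ge> k \<Longrightarrow> if d then Q (w n) (w (Suc n)) else Q (w (Suc n)) (w n)"
        unfolding locally_def eventually_sequentially by blast
      obtain m where m: "m \<in> X" "k < m" using inf by (meson infinite_nat_iff_unbounded)
      obtain n where n: "n \<in> X" "m < n" using inf by (meson infinite_nat_iff_unbounded)
      have "successively Q (block d w m n)"
        unfolding successively_block using k m by (auto simp: in_block_def split: if_splits)
      then show "snd (snd c)" using X[OF m(1) n] by simp
    next
      assume c: "snd (snd c)"
      obtain m where m: "m \<in> X" using inf by (meson infinite_nat_iff_unbounded)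
      \<comment> \<open>Every adjacent pair beyond \<open>m\<close> lies inside a block from
        \<open>m\<close> to a sufficiently distant cut point.\<close>
      have "if d then Q (w k) (w (Suc k)) else Q (w (Suc k)) (w k)" if "k > m" for k
      proof -
        obtain n where n: "n \<in> X" "Suc k < n" using inf by (meson infinite_nat_iff_unbounded)
        then have "successively Q (block d w m n)" using X[OF m n(1)] that c by simp
        then show ?thesis using n that unfolding successively_block in_block_def by auto
      qed
      then show "locally d Q w"
        unfolding locally_def eventually_sequentially by (intro exI[of _ "Suc m"]) auto
    qed
  qed
  ultimately have "recognizes h (\<lambda>d. locally d Q)"
    by (intro recognizesI) blast+
  then show ?thesis by (rule recognizableI)
qed

lemma recognizable_pointwise:
  fixes P :: "'v set \<Rightarrow> bool"
  assumes "finite V" "\<And>a. P a \<longleftrightarrow> P (a \<inter> V)"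
  shows "recognizable (\<lambda>d w. \<forall>\<^sub>F n in sequentially. P (w n))"
proof -
  have "(\<lambda>d. locally d (\<lambda>a b. P a)) = (\<lambda>d w. \<forall>\<^sub>F n in sequentially. P (w n))"
  proof (intro ext)
    fix d and w :: "nat \<Rightarrow> 'v set"
    show "locally d (\<lambda>a b. P a) w \<longleftrightarrow> (\<forall>\<^sub>F n in sequentially. P (w n))"
      using eventually_sequentially_Suc[of "\<lambda>n. P (w n)"] by (cases d) (simp_all add: locally_def)
  qed
  then show ?thesis using recognizable_locally[of V "\<lambda>a b. P a"] assms by metis
qed

subsection \<open>Assignments as words\<close>

text \<open>Truncated subtraction makes 0 its own predecessor when \<open>d\<close> is true; this is
  invisible modulo finite sets.\<close>

definition prev :: "bool \<Rightarrow> nat \<Rightarrow> nat" where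
  "prev d k = (if d then k - 1 else Suc k)"

definition dir_aut :: "bool \<Rightarrow> pow_fin \<Rightarrow> pow_fin" where
  "dir_aut d = (if d then \<sigma> else inv \<sigma>)"

definition assign :: "(nat \<Rightarrow> 'v set) \<Rightarrow> 'v \<Rightarrow> pow_fin" where
  "assign w v = abs_pow_fin {k. v \<in> w k}"

lemma abs_pow_fin_eq_iff:
  "abs_pow_fin X = abs_pow_fin Y \<longleftrightarrow> (\<forall>\<^sub>F k in sequentially. k \<in> X \<longleftrightarrow> k \<in> Y)"
proof -
  have "(X - Y) \<union> (Y - X) = {k. \<not> (k \<in> X \<longleftrightarrow> k \<in> Y)}" by blast
  then show ?thesis
    by (simp add: pow_fin.abs_eq_iff eq_fin_def cofinite_eq_sequentially[symmetric] eventually_cofinite)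
qed

lemma assign_eq_iff:
  "assign w v = assign w' v' \<longleftrightarrow> (\<forall>\<^sub>F k in sequentially. v \<in> w k \<longleftrightarrow> v' \<in> w' k)"
  by (simp add: assign_def abs_pow_fin_eq_iff)

lemma assign_surj:
  obtains w where "assign w = e"
proof
  show "assign (\<lambda>k. {v. k \<in> rep_pow_fin (e v)}) = e"
    by (rule ext) (simp add: assign_def Quotient_abs_rep[OF Quotient_pow_fin])
qed

lemma bij_\<sigma>: "bij \<sigma>"
  using dyn_system_\<sigma> by (simp add: dyn_system_def)

lemma inv_dir_aut: "inv (dir_aut d) = dir_aut (\<not> d)"
  by (simp add: dir_aut_def inv_inv_eq bij_\<sigma>)

lemma eventually_prev:
  "(\<forall>\<^sub>F k in sequentially. P (prev d k) k) \<longleftrightarrow> (\<forall>\<^sub>F k in sequentially. P k (prev (\<not> d) k))"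
  using eventually_sequentially_Suc[of "\<lambda>k. P (k - 1) k"]
    eventually_sequentially_Suc[of "\<lambda>k. P k (k - 1)"]
  by (cases d) (simp_all add: prev_def)

text \<open>Shifting a set up by one makes position \<open>k\<close> carry the membership of
  \<open>k - 1\<close>. Thus each automorphism becomes a look at the letter just read, which puts
  both directions on the same footing.\<close>

lemma dir_aut_abs: "dir_aut d (abs_pow_fin X) = abs_pow_fin {k. prev d k \<in> X}"
proof -
  have *: "\<sigma> (abs_pow_fin Y) = abs_pow_fin Z" if "\<forall>\<^sub>F k in sequentially. k - 1 \<in> Y \<longleftrightarrow> k \<in> Z" for Y Z
  proof -
    have "\<forall>\<^sub>F k in sequentially. k \<in> Suc ` Y \<longleftrightarrow> k \<in> Z"
      using that eventually_gt_at_top[of 0]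
      by eventually_elim (metis Suc_pred' image_iff diff_Suc_1)
    then show ?thesis by (simp add: \<sigma>.abs_eq abs_pow_fin_eq_iff)
  qed
  show ?thesis
  proof (cases d)
    case True
    then show ?thesis using *[of X "{k. prev d k \<in> X}"] by (simp add: dir_aut_def prev_def)
  next
    case False
    have "\<sigma> (abs_pow_fin {k. Suc k \<in> X}) = abs_pow_fin X"
      by (rule *) (use eventually_gt_at_top[of 0] in eventually_elim, simp)
    then show ?thesis using False by (simp add: dir_aut_def prev_def inv_f_eq bij_is_inj bij_\<sigma>)
  qed
qed

lemma locally_iff_prev:
  "locally d Q w \<longleftrightarrow> (\<forall>\<^sub>F k in sequentially. Q (w (prev d k)) (w k))"
  using eventually_sequentially_Suc[of "\<lambda>k. Q (w (k - 1)) (w k)"]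
  by (cases d) (simp_all add: locally_def prev_def)

subsection \<open>Recognizability of first-order formulas\<close>

primrec subterms :: "dyn_term \<Rightarrow> dyn_term set" where
  "subterms (Var v) = {Var v}"
| "subterms Zero = {Zero}"
| "subterms One = {One}"
| "subterms (Compl t) = insert (Compl t) (subterms t)"
| "subterms (Meet s t) = insert (Meet s t) (subterms s \<union> subterms t)"
| "subterms (Join s t) = insert (Join s t) (subterms s \<union> subterms t)"
| "subterms (Aut t) = insert (Aut t) (subterms t)"
| "subterms (AutInv t) = insert (AutInv t) (subterms t)"

lemma finite_subterms [simp]: "finite (subterms t)"
  by (induction t) auto

lemma self_subterm [simp]: "t \<in> subterms t"
  by (cases t) auto

text \<open>A letter is a set of terms claimed to hold at its position; \<open>a\<close> precedes
  \<open>b\<close> in reading order. Each clause checks only the outermost constructor, and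
  \<open>AutInv\<close> constrains the earlier letter because its argument is evaluated one step
  later.\<close>

primrec consistent :: "dyn_term set \<Rightarrow> dyn_term set \<Rightarrow> dyn_term \<Rightarrow> bool" where
  "consistent a b (Var v) \<longleftrightarrow> True"
| "consistent a b Zero \<longleftrightarrow> Zero \<notin> b"
| "consistent a b One \<longleftrightarrow> One \<in> b"
| "consistent a b (Compl t) \<longleftrightarrow> (Compl t \<in> b \<longleftrightarrow> t \<notin> b)"
| "consistent a b (Meet s t) \<longleftrightarrow> (Meet s t \<in> b \<longleftrightarrow> s \<in> b \<and> t \<in> b)"
| "consistent a b (Join s t) \<longleftrightarrow> (Join s t \<in> b \<longleftrightarrow> s \<in> b \<or> t \<in> b)"
| "consistent a b (Aut t) \<longleftrightarrow> (Aut t \<in> b \<longleftrightarrow> t \<in> a)"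
| "consistent a b (AutInv t) \<longleftrightarrow> (AutInv t \<in> a \<longleftrightarrow> t \<in> b)"

lemma consistent_Int: "subterms t \<subseteq> S \<Longrightarrow> consistent a b t \<longleftrightarrow> consistent (a \<inter> S) (b \<inter> S) t"
  by (cases t) (auto dest: subsetD[OF _ self_subterm])

lemma abs_pow_fin_ops:
  "bot = abs_pow_fin {}" "top = abs_pow_fin UNIV" "- abs_pow_fin X = abs_pow_fin (- X)"
  "inf (abs_pow_fin X) (abs_pow_fin Y) = abs_pow_fin (X \<inter> Y)"
  "sup (abs_pow_fin X) (abs_pow_fin Y) = abs_pow_fin (X \<union> Y)"
  by (simp_all add: bot_pow_fin.abs_eq top_pow_fin.abs_eq uminus_pow_fin.abs_eq
      inf_pow_fin.abs_eq sup_pow_fin.abs_eq)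

text \<open>With correct values for proper subterms, the condition on adjacent letters is the
  evaluation clause of the outermost constructor. One direction computes values from guesses, the
  other shows that true values pass the test.\<close>

lemma consistent_iff:
  fixes d
  defines "ev \<equiv> (\<lambda>w. eval_term UNIV (dir_aut d) (\<lambda>v. assign w (Var v)))"
  assumes "\<And>s. s \<in> subterms t \<Longrightarrow> s \<noteq> t \<Longrightarrow> assign w s = ev w s"
  shows "(\<forall>\<^sub>F k in sequentially. consistent (w (prev d k)) (w k) t) \<longleftrightarrow> assign w t = ev w t"
proof (cases t)
  case (AutInv s)
  then have "assign w s = ev w s" using assms(2)[of s] by (cases s) auto
  then have "ev w t = dir_aut (\<not> d) (assign w s)" by (simp add: ev_def AutInv inv_dir_aut)
  then show ?thesis
    using eventually_prev[of "\<lambda>i j. AutInv s \<in> w i \<longleftrightarrow> s \<in> w j" d]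
    by (simp add: AutInv assign_def dir_aut_abs abs_pow_fin_eq_iff)
next
  case (Aut s)
  then have "assign w s = ev w s" using assms(2)[of s] by (cases s) auto
  then have "ev w t = dir_aut d (assign w s)" by (simp add: ev_def Aut)
  then show ?thesis by (simp add: Aut assign_def dir_aut_abs abs_pow_fin_eq_iff)
next
  case (Compl s)
  then have "assign w s = ev w s" using assms(2)[of s] by (cases s) auto
  then have "ev w t = - assign w s" by (simp add: ev_def Compl)
  then show ?thesis by (simp add: Compl assign_def abs_pow_fin_ops abs_pow_fin_eq_iff)
next
  case (Meet r s)
  have "size r < size t" "size s < size t" by (simp_all add: Meet)
  then have "assign w s = ev w s" "assign w r = ev w r"
    using assms(2)[of s] assms(2)[of r] Meet by auto
  then have "ev w t = inf (assign w r) (assign w s)" by (simp add: ev_def Meet)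
  then show ?thesis by (simp add: Meet assign_def abs_pow_fin_ops abs_pow_fin_eq_iff)
next
  case (Join r s)
  have "size r < size t" "size s < size t" by (simp_all add: Join)
  then have "assign w s = ev w s" "assign w r = ev w r"
    using assms(2)[of s] assms(2)[of r] Join by auto
  then have "ev w t = sup (assign w r) (assign w s)" by (simp add: ev_def Join)
  then show ?thesis by (simp add: Join assign_def abs_pow_fin_ops abs_pow_fin_eq_iff)
qed (simp_all add: ev_def assign_def abs_pow_fin_ops abs_pow_fin_eq_iff)

lemma size_subterm: "s \<in> subterms t \<Longrightarrow> s = t \<or> size s < size t"
  by (induction t) auto

lemma eval_of_consistent:
  assumes S: "\<And>t. t \<in> S \<Longrightarrow> subterms t \<subseteq> S"
    and cons: "\<And>t. t \<in> S \<Longrightarrow> \<forall>\<^sub>F k in sequentially. consistent (w (prev d k)) (w k) t"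
  shows "t \<in> S \<Longrightarrow> assign w t = eval_term UNIV (dir_aut d) (\<lambda>v. assign w (Var v)) t"
proof (induction t rule: measure_induct_rule[of size])
  case (less t)
  show ?case
  proof (rule iffD1[OF consistent_iff])
    fix s assume "s \<in> subterms t" "s \<noteq> t"
    then show "assign w s = eval_term UNIV (dir_aut d) (\<lambda>v. assign w (Var v)) s"
      using less size_subterm S by blast
  qed (rule cons[OF less.prems])
qed

text \<open>Nested terms look more than one position away. Guessing the values of all subterms reduces
  this to conditions on adjacent letters.\<close>

lemma recognizable_Eq:
  "recognizable (\<lambda>d w. sat UNIV (dir_aut d) (assign w) (Eq s t))"
proof -
  define S where "S = subterms s \<union> subterms t"
  have S: "finite S" "s \<in> S" "t \<in> S" by (simp_all add: S_def)
  have sub: "r \<in> S \<Longrightarrow> subterms r \<subseteq> S" for r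
  proof -
    have "q \<in> subterms r \<Longrightarrow> r \<in> subterms p \<Longrightarrow> q \<in> subterms p" for p q r
      by (induction p) auto
    then show "r \<in> S \<Longrightarrow> subterms r \<subseteq> S" by (auto simp: S_def)
  qed
  \<comment> \<open>Extended letters keep the given truth values of variables and guess those of all
    other terms.\<close>
  define \<rho> :: "nat set \<Rightarrow> dyn_term set \<Rightarrow> bool" where "\<rho> a b \<longleftrightarrow> (\<forall>v. Var v \<in> b \<longleftrightarrow> v \<in> a)" for a b
  let ?Q = "\<lambda>a b. \<forall>r\<in>S. consistent a b r"
  let ?R = "\<lambda>d w. locally d ?Q w \<and> (\<forall>\<^sub>F k in sequentially. s \<in> w k \<longleftrightarrow> t \<in> w k)"
  have "recognizable (\<lambda>d. locally d ?Q)"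
    by (rule recognizable_locally[OF S(1)]) (use sub consistent_Int in blast)
  moreover have "recognizable (\<lambda>d w. \<forall>\<^sub>F k in sequentially. s \<in> w k \<longleftrightarrow> t \<in> w k)"
    by (rule recognizable_pointwise[OF S(1)]) (use S in simp)
  ultimately have "recognizable ?R" by (rule recognizable_conj)
  moreover have "\<exists>b. \<rho> a b" for a by (rule exI[of _ "Var ` a"]) (auto simp: \<rho>_def)
  ultimately have "recognizable (\<lambda>d w. \<exists>w'. (\<forall>k. \<rho> (w k) (w' k)) \<and> ?R d w')"
    by (intro recognizable_project)
  moreover have "(\<exists>w'. (\<forall>k. \<rho> (w k) (w' k)) \<and> ?R d w') \<longleftrightarrow> sat UNIV (dir_aut d) (assign w) (Eq s t)"
    (is "?L \<longleftrightarrow> ?S") for d w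
  proof
    assume ?L
    then obtain w' where w': "\<And>k. \<rho> (w k) (w' k)" "locally d ?Q w'"
      "\<forall>\<^sub>F k in sequentially. s \<in> w' k \<longleftrightarrow> t \<in> w' k" by blast
    have eq: "(\<lambda>v. assign w' (Var v)) = assign w" using w'(1) by (simp add: assign_def \<rho>_def fun_eq_iff)
    have "\<forall>\<^sub>F k in sequentially. consistent (w' (prev d k)) (w' k) r" if "r \<in> S" for r
      using w'(2) that by (auto simp: locally_iff_prev elim: eventually_mono)
    then have "assign w' s = eval_term UNIV (dir_aut d) (assign w) s"
      "assign w' t = eval_term UNIV (dir_aut d) (assign w) t"
      using eval_of_consistent[of S w' d] sub S(2,3) unfolding eq by blast+
    then show ?S using w'(3) by (simp add: assign_eq_iff[symmetric])
  next
    assume ?S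
    let ?e = "eval_term UNIV (dir_aut d) (assign w)"
    obtain w0 where w0: "assign w0 = ?e" by (rule assign_surj)
    \<comment> \<open>\<open>w0\<close> agrees with \<open>w\<close> on variables only modulo Fin,
      whereas \<rho> demands agreement at every position; hence the variable part is copied from
      \<open>w\<close>.\<close>
    define w' where "w' k = {r. if \<exists>v. r = Var v then r \<in> Var ` w k else r \<in> w0 k}" for k
    have 1: "\<rho> (w k) (w' k)" for k by (auto simp: \<rho>_def w'_def)
    have eq: "(\<lambda>v. assign w' (Var v)) = assign w" using 1 by (simp add: assign_def \<rho>_def fun_eq_iff)
    have ev: "assign w' r = ?e r" for r
    proof (cases "\<exists>v. r = Var v")
      case True
      then show ?thesis using eq by (auto simp: fun_eq_iff)
    next
      case False
      then have "assign w' r = assign w0 r" by (simp add: assign_def w'_def)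
      then show ?thesis by (simp add: w0)
    qed
    have "\<forall>\<^sub>F k in sequentially. consistent (w' (prev d k)) (w' k) r" for r
      using consistent_iff[of r w' d] unfolding eq using ev by simp
    then have "locally d ?Q w'" using S(1) by (simp add: locally_iff_prev eventually_ball_finite)
    moreover have "\<forall>\<^sub>F k in sequentially. s \<in> w' k \<longleftrightarrow> t \<in> w' k"
      using \<open>?S\<close> by (simp add: assign_eq_iff[symmetric] ev)
    ultimately show ?L using 1 by blast
  qed
  ultimately show ?thesis by simp
qed

lemma recognizable_ex:
  assumes "recognizable (\<lambda>d w. P d (assign w))"
  shows "recognizable (\<lambda>d (w :: nat \<Rightarrow> 'v set). \<exists>a. P d ((assign w)(n := a)))"
proof -
  \<comment> \<open>Letters may change only in coordinate \<open>n\<close>, so projection along this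
    relation is quantification over variable \<open>n\<close>.\<close>
  define \<rho> :: "'v set \<Rightarrow> 'v set \<Rightarrow> bool" where "\<rho> a b \<longleftrightarrow> a - {n} = b - {n}" for a b
  have "recognizable (\<lambda>d w. \<exists>w'. (\<forall>k. \<rho> (w k) (w' k)) \<and> P d (assign w'))"
    by (rule recognizable_project) (auto simp: \<rho>_def intro: assms)
  moreover have "(\<exists>w'. (\<forall>k. \<rho> (w k) (w' k)) \<and> P d (assign w')) \<longleftrightarrow> (\<exists>a. P d ((assign w)(n := a)))"
    (is "?L \<longleftrightarrow> ?R") for d w
  proof
    assume ?L
    then obtain w' where w': "\<And>k. \<rho> (w k) (w' k)" "P d (assign w')" by blast
    have "v \<in> w k \<longleftrightarrow> v \<in> w' k" if "v \<noteq> n" for v k using w'(1)[of k] that by (auto simp: \<rho>_def)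
    then have "assign w' = (assign w)(n := assign w' n)" by (auto simp: assign_def fun_eq_iff)
    then show ?R using w'(2) by metis
  next
    assume ?R
    then obtain a where a: "P d ((assign w)(n := a))" by blast
    define w' where "w' k = (w k - {n}) \<union> {v. v = n \<and> k \<in> rep_pow_fin a}" for k
    have "assign w' = (assign w)(n := a)"
      by (auto simp: assign_def fun_eq_iff w'_def Quotient_abs_rep[OF Quotient_pow_fin])
    moreover have "\<rho> (w k) (w' k)" for k by (auto simp: \<rho>_def w'_def)
    ultimately show ?L using a by metis
  qed
  ultimately show ?thesis by simp
qed

text \<open>Induction on formulas: equations are the base, the existential quantifier is projection,
  and the rest reduces to these by complement and conjunction; \<open>Le\<close> is rewritten as an
  equation with a meet.\<close>

theorem recognizable_sat: "recognizable (\<lambda>d w. sat UNIV (dir_aut d) (assign w) \<phi>)"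
proof (induction \<phi>)
  case (Le s t)
  have "sat UNIV (dir_aut d) e (Le s t) \<longleftrightarrow> sat UNIV (dir_aut d) e (Eq (Meet s t) s)" for d e
    by (simp add: le_iff_inf)
  then show ?case using recognizable_Eq by presburger
next
  case (Disj \<phi> \<psi>)
  then show ?case
    using recognizable_not[OF recognizable_conj[OF recognizable_not recognizable_not]] by fastforce
next
  case (Imp \<phi> \<psi>)
  then show ?case
    using recognizable_not[OF recognizable_conj[OF _ recognizable_not]] by fastforce
next
  case (All n \<phi>)
  have "recognizable (\<lambda>d w. \<not> (\<exists>a. \<not> sat UNIV (dir_aut d) ((assign w)(n := a)) \<phi>))"
    by (intro recognizable_not recognizable_ex[where P = "\<lambda>d e. \<not> sat UNIV (dir_aut d) e \<phi>"] All)
  then show ?case by simp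
next
  case (Ex n \<phi>)
  have "recognizable (\<lambda>d w. \<exists>a. sat UNIV (dir_aut d) ((assign w)(n := a)) \<phi>)"
    by (rule recognizable_ex[where P = "\<lambda>d e. sat UNIV (dir_aut d) e \<phi>"]) (rule Ex)
  then show ?case by simp
qed (simp_all add: recognizable_Eq[simplified] recognizable_not recognizable_conj)

subsection \<open>Transfer along embeddings\<close>

primrec term_bound :: "dyn_term \<Rightarrow> nat" where
  "term_bound (Var v) = Suc v"
| "term_bound Zero = 0"
| "term_bound One = 0"
| "term_bound (Compl t) = term_bound t"
| "term_bound (Meet s t) = max (term_bound s) (term_bound t)"
| "term_bound (Join s t) = max (term_bound s) (term_bound t)"
| "term_bound (Aut t) = term_bound t"
| "term_bound (AutInv t) = term_bound t"

text \<open>Bound occurrences are counted too, so this may overestimate but never misses a free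
  variable.\<close>

primrec form_bound :: "dyn_form \<Rightarrow> nat" where
  "form_bound (Eq s t) = max (term_bound s) (term_bound t)"
| "form_bound (Le s t) = max (term_bound s) (term_bound t)"
| "form_bound (Neg \<phi>) = form_bound \<phi>"
| "form_bound (Conj \<phi> \<psi>) = max (form_bound \<phi>) (form_bound \<psi>)"
| "form_bound (Disj \<phi> \<psi>) = max (form_bound \<phi>) (form_bound \<psi>)"
| "form_bound (Imp \<phi> \<psi>) = max (form_bound \<phi>) (form_bound \<psi>)"
| "form_bound (All n \<phi>) = form_bound \<phi>"
| "form_bound (Ex n \<phi>) = form_bound \<phi>"

lemma eval_term_cong:
  "(\<And>v. v < term_bound t \<Longrightarrow> e v = e' v) \<Longrightarrow> eval_term A \<alpha> e t = eval_term A \<alpha> e' t"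
  by (induction t) auto

lemma sat_cong:
  "(\<And>v. v < form_bound \<phi> \<Longrightarrow> e v = e' v) \<Longrightarrow> sat A \<alpha> e \<phi> \<longleftrightarrow> sat A \<alpha> e' \<phi>"
proof (induction \<phi> arbitrary: e e')
  case (Eq s t)
  then show ?case using eval_term_cong[of s e e' A \<alpha>] eval_term_cong[of t e e' A \<alpha>] by simp
next
  case (Le s t)
  then show ?case using eval_term_cong[of s e e' A \<alpha>] eval_term_cong[of t e e' A \<alpha>] by simp
next
  case (All n \<phi>)
  have "sat A \<alpha> (e(n := a)) \<phi> \<longleftrightarrow> sat A \<alpha> (e'(n := a)) \<phi>" for a
    by (rule All.IH) (use All.prems in simp)
  then show ?case by simp
next
  case (Ex n \<phi>)
  have "sat A \<alpha> (e(n := a)) \<phi> \<longleftrightarrow> sat A \<alpha> (e'(n := a)) \<phi>" for a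
    by (rule Ex.IH) (use Ex.prems in simp)
  then show ?case by simp
next
  case (Neg \<phi>)
  have "sat A \<alpha> e \<phi> \<longleftrightarrow> sat A \<alpha> e' \<phi>" by (rule Neg.IH) (use Neg.prems in simp)
  then show ?case by simp
next
  case (Conj \<phi> \<psi>)
  have "sat A \<alpha> e \<phi> \<longleftrightarrow> sat A \<alpha> e' \<phi>" by (rule Conj.IH) (use Conj.prems in simp)
  moreover have "sat A \<alpha> e \<psi> \<longleftrightarrow> sat A \<alpha> e' \<psi>" by (rule Conj.IH) (use Conj.prems in simp)
  ultimately show ?case by simp
next
  case (Disj \<phi> \<psi>)
  have "sat A \<alpha> e \<phi> \<longleftrightarrow> sat A \<alpha> e' \<phi>" by (rule Disj.IH) (use Disj.prems in simp)
  moreover have "sat A \<alpha> e \<psi> \<longleftrightarrow> sat A \<alpha> e' \<psi>" by (rule Disj.IH) (use Disj.prems in simp)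
  ultimately show ?case by simp
next
  case (Imp \<phi> \<psi>)
  have "sat A \<alpha> e \<phi> \<longleftrightarrow> sat A \<alpha> e' \<phi>" by (rule Imp.IH) (use Imp.prems in simp)
  moreover have "sat A \<alpha> e \<psi> \<longleftrightarrow> sat A \<alpha> e' \<psi>" by (rule Imp.IH) (use Imp.prems in simp)
  ultimately show ?case by simp
qed

lemma sat_foldr_Ex:
  "sat A \<alpha> e (foldr Ex vs \<phi>) \<longleftrightarrow>
    (\<exists>e'. (\<forall>v. v \<notin> set vs \<longrightarrow> e' v = e v) \<and> e' ` set vs \<subseteq> A \<and> sat A \<alpha> e' \<phi>)"
proof (induction vs arbitrary: e)
  case Nil
  have "(\<forall>v. e' v = e v) \<longleftrightarrow> e' = e" for e' by (simp add: fun_eq_iff)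
  then show ?case by simp
next
  case (Cons n vs)
  show ?case
  proof
    assume "sat A \<alpha> e (foldr Ex (n # vs) \<phi>)"
    then obtain a e' where "a \<in> A" "\<forall>v. v \<notin> set vs \<longrightarrow> e' v = (e(n := a)) v" "e' ` set vs \<subseteq> A"
      "sat A \<alpha> e' \<phi>"
      using Cons.IH by auto
    then show "\<exists>e'. (\<forall>v. v \<notin> set (n # vs) \<longrightarrow> e' v = e v) \<and> e' ` set (n # vs) \<subseteq> A \<and> sat A \<alpha> e' \<phi>"
      by (intro exI[of _ e']) (auto, metis fun_upd_same image_subset_iff)
  next
    assume "\<exists>e'. (\<forall>v. v \<notin> set (n # vs) \<longrightarrow> e' v = e v) \<and> e' ` set (n # vs) \<subseteq> A \<and> sat A \<alpha> e' \<phi>"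
    then obtain e' where "\<forall>v. v \<notin> set (n # vs) \<longrightarrow> e' v = e v" "e' ` set (n # vs) \<subseteq> A" "sat A \<alpha> e' \<phi>"
      by blast
    then have "e' n \<in> A" "sat A \<alpha> (e(n := e' n)) (foldr Ex vs \<phi>)"
      unfolding Cons.IH by auto
    then show "sat A \<alpha> e (foldr Ex (n # vs) \<phi>)" by auto
  qed
qed

text \<open>Only the inverse automorphism needs an argument: bijectivity of \<alpha> on
  \<open>A\<close> gives a preimage inside \<open>A\<close>, and injectivity of \<beta> identifies
  its image.\<close>

lemma eval_term_embedding:
  assumes "dyn_embedding A \<alpha> UNIV \<beta> \<eta>" "range e \<subseteq> A"
  shows "eval_term A \<alpha> e t \<in> A \<and> eval_term UNIV \<beta> (\<eta> \<circ> e) t = \<eta> (eval_term A \<alpha> e t)"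
proof (induction t)
  case (AutInv t)
  let ?x = "eval_term A \<alpha> e t"
  have bij: "bij_betw \<alpha> A A" "bij \<beta>" and eq: "\<And>x. x \<in> A \<Longrightarrow> \<eta> (\<alpha> x) = \<beta> (\<eta> x)"
    using assms(1) by (simp_all add: dyn_embedding_def dyn_system_def)
  have "?x \<in> \<alpha> ` A" using AutInv bij(1) by (simp add: bij_betw_def)
  then have x: "inv_into A \<alpha> ?x \<in> A" "\<alpha> (inv_into A \<alpha> ?x) = ?x"
    by (rule inv_into_into, rule f_inv_into_f)
  then have "\<beta> (\<eta> (inv_into A \<alpha> ?x)) = \<eta> ?x" using eq by metis
  then have "inv \<beta> (\<eta> ?x) = \<eta> (inv_into A \<alpha> ?x)" using bij(2) by (simp add: inv_f_eq bij_is_inj)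
  then show ?case using x AutInv by simp
qed (use assms in \<open>auto simp: dyn_embedding_def dyn_system_def subalgebra_def boolean_hom_def\<close>)

section \<open>Terms for local conditions, and marked factorizations\<close>

text \<open>Shannon expansion: split on membership in the set denoted by \<open>f\<close> and
  recurse on both cofactors. The term is chosen before the interpretation, so one term serves both
  directions.\<close>

lemma term_denoting:
  assumes "finite F"
  shows "\<exists>t. \<forall>\<alpha> e E. (\<forall>s\<in>F. eval_term UNIV \<alpha> e s = abs_pow_fin (E s)) \<longrightarrow>
    eval_term UNIV \<alpha> e t = abs_pow_fin {k. P {s \<in> F. k \<in> E s}}"
  using assms
proof (induction F arbitrary: P)
  case empty
  show ?case by (intro exI[of _ "if P {} then One else Zero"]) (simp add: abs_pow_fin_ops)
next
  case (insert f F)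
  obtain t1 where t1: "\<And>\<alpha> e E. \<forall>s\<in>F. eval_term UNIV \<alpha> e s = abs_pow_fin (E s) \<Longrightarrow>
    eval_term UNIV \<alpha> e t1 = abs_pow_fin {k. P (insert f {s \<in> F. k \<in> E s})}"
    using insert.IH[of "\<lambda>c. P (insert f c)"] by blast
  obtain t0 where t0: "\<And>\<alpha> e E. \<forall>s\<in>F. eval_term UNIV \<alpha> e s = abs_pow_fin (E s) \<Longrightarrow>
    eval_term UNIV \<alpha> e t0 = abs_pow_fin {k. P {s \<in> F. k \<in> E s}}"
    using insert.IH[of P] by blast
  show ?case
  proof (intro exI[of _ "Join (Meet f t1) (Meet (Compl f) t0)"] allI impI)
    fix \<alpha> e and E :: "dyn_term \<Rightarrow> nat set"
    assume *: "\<forall>s\<in>insert f F. eval_term UNIV \<alpha> e s = abs_pow_fin (E s)"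
    have "{s \<in> insert f F. k \<in> E s} = (if k \<in> E f then insert f {s \<in> F. k \<in> E s} else {s \<in> F. k \<in> E s})" for k
      by auto
    then have "{k. P {s \<in> insert f F. k \<in> E s}} =
      E f \<inter> {k. P (insert f {s \<in> F. k \<in> E s})} \<union> - E f \<inter> {k. P {s \<in> F. k \<in> E s}}" by auto
    then show "eval_term UNIV \<alpha> e (Join (Meet f t1) (Meet (Compl f) t0)) =
      abs_pow_fin {k. P {s \<in> insert f F. k \<in> E s}}"
      using * t1[of \<alpha> e E] t0[of \<alpha> e E] by (simp add: abs_pow_fin_ops)
  qed
qed

text \<open>The terms \<open>Var v\<close> and \<open>Aut (Var v)\<close> read the current and the
  preceding letter. Only \<open>v < M\<close> matters, so the condition is a Boolean combination of
  finitely many such terms.\<close>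

lemma term_denoting_locally:
  assumes Q: "\<And>a b. Q a b \<longleftrightarrow> Q (a \<inter> {..<M}) (b \<inter> {..<M})"
  shows "\<exists>t. \<forall>d e w. (\<forall>v<M. e v = assign w v) \<longrightarrow>
    (eval_term UNIV (dir_aut d) e t = top \<longleftrightarrow> locally d Q w)"
proof -
  let ?F = "Var ` {..<M} \<union> (\<lambda>v. Aut (Var v)) ` {..<M}"
  let ?P = "\<lambda>c. Q {v. Aut (Var v) \<in> c} {v. Var v \<in> c}"
  have "finite ?F" by simp
  then obtain t where t: "\<And>\<alpha> e E. \<forall>s\<in>?F. eval_term UNIV \<alpha> e s = abs_pow_fin (E s) \<Longrightarrow>
    eval_term UNIV \<alpha> e t = abs_pow_fin {k. ?P {s \<in> ?F. k \<in> E s}}"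
    using term_denoting[of ?F ?P] by blast
  show ?thesis
  proof (intro exI[of _ t] allI impI)
    fix d e and w :: "nat \<Rightarrow> nat set"
    assume e: "\<forall>v<M. e v = assign w v"
    \<comment> \<open>Representatives of the sets denoted by the terms in \<open>?F\<close>; the
      branches with \<open>False\<close> concern only terms outside \<open>?F\<close>.\<close>
    define E where "E s = {k. case s of Var v \<Rightarrow> v \<in> w k | Aut r \<Rightarrow> (case r of Var v \<Rightarrow> v \<in> w (prev d k) | _ \<Rightarrow> False) | _ \<Rightarrow> False}" for s
    have "\<forall>s\<in>?F. eval_term UNIV (dir_aut d) e s = abs_pow_fin (E s)"
      by (auto simp: E_def e assign_def dir_aut_abs)
    then have ev: "eval_term UNIV (dir_aut d) e t = abs_pow_fin {k. ?P {s \<in> ?F. k \<in> E s}}" by (rule t)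
    have P: "?P {s \<in> ?F. k \<in> E s} \<longleftrightarrow> Q (w (prev d k)) (w k)" for k
    proof -
      have "{v. Aut (Var v) \<in> {s \<in> ?F. k \<in> E s}} = w (prev d k) \<inter> {..<M}"
        "{v. Var v \<in> {s \<in> ?F. k \<in> E s}} = w k \<inter> {..<M}" by (auto simp: E_def)
      then show ?thesis using Q[of "w (prev d k)" "w k"] by simp
    qed
    show "eval_term UNIV (dir_aut d) e t = top \<longleftrightarrow> locally d Q w"
      unfolding ev P by (simp add: abs_pow_fin_ops abs_pow_fin_eq_iff locally_iff_prev)
  qed
qed

text \<open>Variable \<open>N\<close> marks the cut points, and variable \<open>Suc (N + s)\<close> the positions where the part
  read since the last cut point has value \<open>s\<close>.\<close>

definition states :: "(nat set list \<Rightarrow> nat) \<Rightarrow> nat \<Rightarrow> nat set \<Rightarrow> nat set" where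
  "states h N a = {s \<in> range h. Suc (N + s) \<in> a}"

text \<open>At a cut point the finished part must have value \<open>c\<close> and the record
  restarts with the cut letter; elsewhere one letter is appended. The word \<open>v\<close> merely
  represents the recorded value, since for a congruence the next value does not depend on its
  choice.\<close>

definition step :: "(nat set list \<Rightarrow> nat) \<Rightarrow> nat \<Rightarrow> nat \<Rightarrow> nat set \<Rightarrow> nat set \<Rightarrow> bool" where
  "step h N c a b \<longleftrightarrow> (if N \<in> b then states h N a = {c} \<and> states h N b = {h [b]}
     else \<exists>v. v \<noteq> [] \<and> states h N a = {h v} \<and> states h N b = {h (v @ [b])})"

definition supported :: "('v set list \<Rightarrow> 's) \<Rightarrow> 'v set \<Rightarrow> bool" where
  "supported h V \<longleftrightarrow> (\<forall>u. h (map (\<lambda>a. a \<inter> V) u) = h u)"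

lemma supportedD:
  assumes "supported h V" "map (\<lambda>a. a \<inter> V) u = map (\<lambda>a. a \<inter> V) v"
  shows "h u = h v"
  using assms unfolding supported_def by metis

lemma step_Int:
  assumes h: "supported h {..<N}" and N: "N < M" "\<And>s. s \<in> range h \<Longrightarrow> Suc (N + s) < M"
  shows "step h N c a b \<longleftrightarrow> step h N c (a \<inter> {..<M}) (b \<inter> {..<M})"
proof -
  have "states h N x = states h N (x \<inter> {..<M})" for x using N(2) by (auto simp: states_def)
  moreover have "h (v @ [b]) = h (v @ [b \<inter> {..<M}])" for v
    using N(1) by (intro supportedD[OF h]) auto
  moreover from this[of "[]"] have "h [b] = h [b \<inter> {..<M}]" by simp
  ultimately show ?thesis using N(1) by (simp add: step_def)
qed

text \<open>The letter \<open>y\<close> before the part supplies the step into the cut point, which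
  resets the record; each later step appends one letter.\<close>

lemma states_last:
  assumes "congruence h"
  shows "successively (step h N c) (y # u) \<Longrightarrow> u \<noteq> [] \<Longrightarrow> N \<in> hd u \<Longrightarrow> \<forall>a\<in>set (tl u). N \<notin> a \<Longrightarrow>
    states h N (last u) = {h u}"
proof (induction u rule: rev_induct)
  case (snoc a u)
  show ?case
  proof (cases "u = []")
    case True
    then show ?thesis using snoc.prems by (simp add: step_def)
  next
    case False
    have "successively (step h N c) ((y # u) @ [a])" using snoc.prems(1) by simp
    then have "successively (step h N c) (y # u)" and st: "step h N c (last u) a"
      using False by (simp_all only: successively_append_iff) simp_all
    then have "states h N (last u) = {h u}" using snoc False by simp
    moreover have "N \<notin> a" using snoc.prems False by simp
    ultimately obtain v where "v \<noteq> []" "h u = h v" "states h N a = {h (v @ [a])}"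
      using st by (auto simp: step_def)
    then show ?thesis using congruenceD[OF assms, of u v "[a]" "[a]"] False by simp
  qed
qed simp

lemma homog_of_step:
  assumes "congruence h" "idem_value h c" and step: "locally d (step h N c) w"
    and inf: "infinite {k. N \<in> w k}"
  shows "\<exists>X. homog d h w X c"
proof -
  obtain K where K: "\<And>n. n \<ge> K \<Longrightarrow> if d then step h N c (w n) (w (Suc n)) else step h N c (w (Suc n)) (w n)"
    using step unfolding locally_def eventually_sequentially by blast
  \<comment> \<open>Dropping cut points up to \<open>K\<close> makes every step that touches a block
    obey the rule, including the one from position \<open>m - 1\<close> when reading
    forwards.\<close>
  define X where "X = {k. N \<in> w k} - {..K}"
  have "infinite X" using inf by (simp add: X_def)
  moreover have "h (block d w m n) = c" if "consec X m n" for m n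
  proof -
    have mn: "K < m" "m < n" "N \<in> w m" "N \<in> w n" and gap: "\<And>k. m < k \<Longrightarrow> k < n \<Longrightarrow> N \<notin> w k"
      using that by (auto simp: consec_def X_def)
    let ?u = "block d w m n"
    have ne: "?u \<noteq> []" using mn by simp
    have one: "block d w k (Suc k) = [if d then w k else w (Suc k)]" for k by (simp add: block_def)
    \<comment> \<open>In reading order the block is flanked by the preceding letter \<open>y\<close>
      and the letter \<open>z\<close> of the next cut point: \<open>w n\<close> forwards,
      \<open>w m\<close> backwards.\<close>
    obtain y z where yz: "block d w (m - 1) (Suc n) = y # ?u @ [z]" "N \<in> z"
    proof -
      have 1: "block d w (m - 1) (Suc n) =
          (if d then block d w (m - 1) m @ block d w m (Suc n) else block d w m (Suc n) @ block d w (m - 1) m)"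
        using mn by (intro block_append) auto
      have 2: "block d w m (Suc n) = (if d then ?u @ block d w n (Suc n) else block d w n (Suc n) @ ?u)"
        using mn by (intro block_append) auto
      have 3: "block d w (m - 1) m = [if d then w (m - 1) else w m]" using one[of "m - 1"] mn by simp
      have "block d w (m - 1) (Suc n) = (if d then [w (m - 1)] @ ?u @ [w n] else [w (Suc n)] @ ?u @ [w m])"
        unfolding 1 2 3 one by simp
      then show ?thesis using that[of _ "w n"] that[of _ "w m"] mn by (cases d) simp_all
    qed
    have "successively (step h N c) (y # ?u @ [z])"
      unfolding yz(1)[symmetric] successively_block
      using K mn by (auto simp: in_block_def split: if_splits)
    then have "successively (step h N c) ((y # ?u) @ [z])" by simp
    then have succ: "successively (step h N c) (y # ?u)" "step h N c (last ?u) z"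
      using ne by (simp_all only: successively_append_iff) simp_all
    have "hd ?u = (if d then w m else w n) \<and> set (tl ?u) = w ` {m<..<n}"
    proof (cases d)
      case True
      have "[m..<n] = m # [Suc m..<n]" using mn by (simp add: upt_conv_Cons)
      then show ?thesis using True by (auto simp: block_def)
    next
      case False
      have "[Suc m..<Suc n] = [Suc m..<n] @ [n]" using mn by simp
      then show ?thesis using False by (auto simp: block_def simp del: upt_Suc)
    qed
    then have hd: "hd ?u = (if d then w m else w n)" and tl: "set (tl ?u) = w ` {m<..<n}" by auto
    have "states h N (last ?u) = {h ?u}"
      by (rule states_last[OF assms(1) succ(1) ne]) (use hd tl mn gap in auto)
    \<comment> \<open>The step into the cut letter \<open>z\<close> forces the recorded value of the
      block to be \<open>c\<close>.\<close>
    then show ?thesis using succ(2) yz(2) by (simp add: step_def)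
  qed
  ultimately show ?thesis using homog_of_consec[of X h c d w] assms(2) by blast
qed

lemma step_of_homog:
  assumes h: "supported h {..<N}" and hom: "homog d h w X c"
  obtains w' where "locally d (step h N c) w'" "infinite {k. N \<in> w' k}"
    "\<And>k. w' k \<inter> {..<N} = w k \<inter> {..<N}"
proof -
  have inf: "infinite X" and X: "\<And>m n. m \<in> X \<Longrightarrow> n \<in> X \<Longrightarrow> m < n \<Longrightarrow> h (block d w m n) = c"
    using hom by (auto simp: homog_def)
  \<comment> \<open>The cut point most recently passed when \<open>k\<close> is read, hence the
    nearest one at or above \<open>k\<close> when reading backwards.\<close>
  define start where "start k = (if d then Max {x \<in> X. x \<le> k} else (LEAST x. x \<in> X \<and> k \<le> x))" for k
  \<comment> \<open>What has been read from that cut point through \<open>k\<close>; the bounds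
    \<open>Suc k\<close> and \<open>k - 1\<close> include position \<open>k\<close> itself.\<close>
  define run where "run k = (if d then block d w (start k) (Suc k) else block d w (k - 1) (start k))" for k
  define w' where "w' k = (w k \<inter> {..<N}) \<union> {v. v = N \<and> k \<in> X} \<union> {Suc (N + h (run k))}" for k
  have N: "N \<in> w' k \<longleftrightarrow> k \<in> X" for k by (auto simp: w'_def)
  have states: "states h N (w' k) = {h (run k)}" for k by (auto simp: states_def w'_def)
  have low: "w' k \<inter> {..<N} = w k \<inter> {..<N}" for k by (auto simp: w'_def)
  have letter: "h (v @ [w' k]) = h (v @ [w k])" for v k
    by (rule supportedD[OF h]) (simp add: low)
  \<comment> \<open>Forwards, a position needs a cut point at or below it; from \<open>m0\<close> on
    this is ensured.\<close>
  obtain m0 where m0: "m0 \<in> X" using inf by (meson infinite_nat_iff_unbounded)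
  have start: "start k \<in> X \<and> (if d then start k \<le> k else k \<le> start k)" if "m0 \<le> k" for k
  proof (cases d)
    case True
    have "finite {x \<in> X. x \<le> k}" "{x \<in> X. x \<le> k} \<noteq> {}" using m0 that by auto
    then have "Max {x \<in> X. x \<le> k} \<in> {x \<in> X. x \<le> k}" by (rule Max_in)
    then show ?thesis using True by (simp add: start_def)
  next
    case False
    obtain x where "x \<in> X" "k \<le> x" using inf by (meson infinite_nat_iff_unbounded_le)
    then show ?thesis
      using False LeastI[of "\<lambda>x. x \<in> X \<and> k \<le> x" x] by (simp add: start_def)
  qed
  have start_in: "start k = k" if "k \<in> X" for k
    using that by (auto simp: start_def intro!: Max_eqI Least_equality)
  have start_out: "start (prev d k) = start k" if "k \<notin> X" "0 < k" for k
  proof (cases d)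
    case True
    have "x \<in> X \<and> x \<le> k - 1 \<longleftrightarrow> x \<in> X \<and> x \<le> k" for x using that by (cases "x = k") auto
    then show ?thesis using True by (simp add: start_def prev_def)
  next
    case False
    have "x \<in> X \<and> Suc k \<le> x \<longleftrightarrow> x \<in> X \<and> k \<le> x" for x using that by (cases "x = k") auto
    then show ?thesis using False by (simp add: start_def prev_def)
  qed
  have "step h N c (w' (prev d k)) (w' k)" if k: "m0 < k" for k
  proof -
    define p where "p = prev d k"
    have p: "p = (if d then k - 1 else Suc k)" by (simp add: p_def prev_def)
    have sp: "start p \<in> X" "if d then start p \<le> p else p \<le> start p"
      using start[of p] k p by (auto split: if_splits)
    have run_p: "run p = (if d then block d w (start p) k else block d w k (start p))"
      using k p by (simp add: run_def)
    have one: "block d w (k - (if d then 0 else 1)) (if d then Suc k else k) = [w k]"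
      using k by (simp add: block_def)
    show ?thesis
    proof (cases "k \<in> X")
      case True
      \<comment> \<open>At a cut point the run of the preceding position is a whole block between
        two elements of \<open>X\<close>.\<close>
      have "h (run p) = c" unfolding run_p
        using X[of "start p" k] X[of k "start p"] sp True p k by (auto split: if_splits)
      moreover have "run k = [w k]" using one start_in[OF True] by (cases d) (simp_all add: run_def)
      ultimately show ?thesis using True letter[of "[]"] by (simp add: step_def N states p_def)
    next
      case False
      have "start k = start p" using start_out[OF False] k by (simp add: p_def)
      then have "run k = run p @ [w k]"
        using one sp p k block_append[of "start p" k "Suc k" d w]
          block_append[of "k - 1" k "start p" d w]
        unfolding run_p by (cases d) (simp_all add: run_def)
      moreover have "run p \<noteq> []" unfolding run_p using sp p k by (auto split: if_splits)
      ultimately show ?thesis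
        using False letter[of "run p"] by (auto simp add: step_def N states p_def)
    qed
  qed
  then have "locally d (step h N c) w'"
    unfolding locally_iff_prev eventually_at_top_dense by blast
  then show ?thesis using that low inf by (simp add: N)
qed

section \<open>Transfer of truth by an existential formula\<close>

lemma block_map: "map f (block d w m n) = block d (f \<circ> w) m n"
  by (simp add: block_def)

text \<open>Truth depends only on the letters cut down to \<open>V\<close>, so \<open>h\<close> may
  be fed those. The variables from \<open>N\<close> on thereby become free for marking.\<close>

lemma recognizes_supported:
  assumes "recognizes h R" and R: "\<And>d w. R d w \<longleftrightarrow> R d (\<lambda>k. w k \<inter> V)"
  shows "recognizes (\<lambda>u. h (map (\<lambda>a. a \<inter> V) u)) R" (is "recognizes ?h R")
proof (rule recognizesI)
  show "finite (range ?h)"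
    by (rule finite_subset[OF _ recognizesD(1)[OF assms(1)]]) auto
  show "congruence ?h"
    using recognizesD(2)[OF assms(1)] by (simp add: congruence_def)
  have hom: "homog d h (\<lambda>k. w k \<inter> V) X c" if "homog d ?h w X c" for d w X c
    using that by (simp add: homog_def block_map comp_def)
  show "R d' w'" if "homog d ?h w X c" "homog d' ?h w' X' c" "R d w" for d d' w w' X X' c
    using recognizesD(3)[OF assms(1) hom[OF that(1)] hom[OF that(2)]] that(3) R by blast
qed

text \<open>The formula \<open>\<psi>\<close> of the proof says that a homogeneous factorization with value \<open>c\<close> exists.
  It is existential over a quantifier-free matrix, so witnesses found in \<open>A\<close> by elementarity
  are carried along by the embedding.\<close>

lemma sat_transfer:
  assumes A: "elementary_substructure A UNIV (dir_aut d)"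
    and \<eta>: "dyn_embedding A (dir_aut d) UNIV (dir_aut d') \<eta>"
    and e: "range e \<subseteq> A" and sat: "sat A (dir_aut d) e \<phi>"
  shows "sat UNIV (dir_aut d') (\<eta> \<circ> e) \<phi>"
proof -
  have elem: "sat A (dir_aut d) e \<psi> \<longleftrightarrow> sat UNIV (dir_aut d) e \<psi>" for \<psi>
    using A e by (simp add: elementary_substructure_def elementary_embedding_def)
  let ?R = "\<lambda>d w. sat UNIV (dir_aut d) (assign w) \<phi>"
  define N where "N = form_bound \<phi>"
  obtain h0 :: "nat set list \<Rightarrow> nat" where "recognizes h0 ?R"
    using recognizable_sat by (auto simp: recognizable_def)
  define h where "h u = h0 (map (\<lambda>a. a \<inter> {..<N}) u)" for u
  have "?R d w \<longleftrightarrow> ?R d (\<lambda>k. w k \<inter> {..<N})" for d w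
    by (rule sat_cong) (simp add: N_def assign_def)
  then have h: "recognizes h ?R"
    unfolding h_def by (rule recognizes_supported[OF \<open>recognizes h0 ?R\<close>])
  have supp: "supported h {..<N}" by (simp add: supported_def h_def comp_def)
  obtain w where w: "assign w = e" by (rule assign_surj)
  obtain X c where X: "homog d h w X c"
    using homog_exists[OF recognizesD(1)[OF h] infinite_UNIV_nat] by blast
  obtain w1 where w1: "locally d (step h N c) w1" "infinite {k. N \<in> w1 k}"
    "\<And>k. w1 k \<inter> {..<N} = w k \<inter> {..<N}"
    using step_of_homog[OF supp X] by blast
  \<comment> \<open>\<open>M\<close> exceeds the marking variables of all values in
    \<open>range h\<close>.\<close>
  define M where "M = Suc (Suc (N + Max (range h)))"
  have M: "N < M" "\<And>s. s \<in> range h \<Longrightarrow> Suc (N + s) < M"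
    using Max_ge[OF recognizesD(1)[OF h]] by (simp_all add: M_def le_imp_less_Suc)
  have "step h N c a b \<longleftrightarrow> step h N c (a \<inter> {..<M}) (b \<inter> {..<M})" for a b
    by (rule step_Int[OF supp M])
  then obtain t where t: "\<forall>d e w. (\<forall>v<M. e v = assign w v) \<longrightarrow>
      (eval_term UNIV (dir_aut d) e t = top \<longleftrightarrow> locally d (step h N c) w)"
    using term_denoting_locally by metis
  \<comment> \<open>The first conjunct says that there are infinitely many cut points, the second
    that almost every step obeys \<open>step\<close>.\<close>
  define \<psi> where "\<psi> = Conj (Neg (Eq (Var N) Zero)) (Eq t One)"
  have \<psi>: "sat UNIV (dir_aut d) e \<psi> \<longleftrightarrow> infinite {k. N \<in> w k} \<and> locally d (step h N c) w"
    if e: "\<And>v. v < M \<Longrightarrow> e v = assign w v" for d e w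
  proof -
    have "eval_term UNIV (dir_aut d) e t = top \<longleftrightarrow> locally d (step h N c) w" using t e by blast
    moreover have "e N = bot \<longleftrightarrow> finite {k. N \<in> w k}"
      unfolding e[OF M(1)] assign_def abs_pow_fin_ops(1) by (simp add: pow_fin.abs_eq_iff eq_fin_def)
    ultimately show ?thesis by (simp add: \<psi>_def)
  qed
  define e1 where "e1 v = (if v \<in> {N..<M} then assign w1 v else e v)" for v
  have "e1 v = assign w1 v" if "v < M" for v
  proof (cases "v < N")
    case True
    then have "v \<in> w1 k \<longleftrightarrow> v \<in> w k" for k using w1(3)[of k] by blast
    then show ?thesis using True by (simp add: e1_def w[symmetric] assign_def)
  qed (use that in \<open>simp add: e1_def\<close>)
  then have "sat UNIV (dir_aut d) e1 \<psi>" using \<psi> w1 by simp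
  then have "sat UNIV (dir_aut d) e (foldr Ex [N..<M] \<psi>)"
    unfolding sat_foldr_Ex by (intro exI[of _ e1]) (simp add: e1_def)
  then have "sat A (dir_aut d) e (foldr Ex [N..<M] \<psi>)" by (simp only: elem)
  then obtain e2 where e2: "\<forall>v. v \<notin> {N..<M} \<longrightarrow> e2 v = e v" "e2 ` {N..<M} \<subseteq> A"
    "sat A (dir_aut d) e2 \<psi>"
    unfolding sat_foldr_Ex set_upt by blast
  have rng: "range e2 \<subseteq> A"
  proof clarify
    fix v show "e2 v \<in> A" using e2(1,2) e by (cases "v \<in> {N..<M}") auto
  qed
  note ev = eval_term_embedding[OF \<eta> rng]
  have \<eta>_bot: "\<eta> bot = bot" "\<eta> top = top" "inj_on \<eta> A" "bot \<in> A"
    using \<eta> by (simp_all add: dyn_embedding_def boolean_hom_def dyn_system_def subalgebra_def)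
  have "\<eta> (e2 N) = bot \<longleftrightarrow> e2 N = bot"
    using inj_on_eq_iff[OF \<eta>_bot(3), of "e2 N" bot] \<eta>_bot rng by auto
  then have sat2: "sat UNIV (dir_aut d') (\<eta> \<circ> e2) \<psi>"
    using e2(3) ev[of t] \<eta>_bot(2) by (simp add: \<psi>_def)
  \<comment> \<open>A word for the image assignment, read in direction \<open>d'\<close>, inherits
    infinitely many cut points and the step rule, hence has a factorization with the same
    \<open>c\<close>.\<close>
  obtain w2 where w2: "assign w2 = \<eta> \<circ> e2" by (rule assign_surj)
  have "idem_value h c" by (rule homog_idem[OF recognizesD(2)[OF h] X])
  then obtain X2 where "homog d' h w2 X2 c"
    using homog_of_step[OF recognizesD(2)[OF h], of c d' N w2] \<psi>[of "\<eta> \<circ> e2" w2 d'] sat2 w2 by auto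
  moreover have "?R d w" using sat elem w by simp
  ultimately have "?R d' w2" using recognizesD(3)[OF h X] by blast
  moreover have "(\<eta> \<circ> e2) v = (\<eta> \<circ> e) v" if "v < form_bound \<phi>" for v
    using that e2(1) by (simp add: N_def)
  ultimately show ?thesis unfolding w2 using sat_cong[of \<phi> "\<eta> \<circ> e2" "\<eta> \<circ> e"] by blast
qed

lemma sat_transfer_iff:
  assumes "elementary_substructure A UNIV (dir_aut d)"
    and "dyn_embedding A (dir_aut d) UNIV (dir_aut d') \<eta>" "range e \<subseteq> A"
  shows "sat A (dir_aut d) e \<phi> \<longleftrightarrow> sat UNIV (dir_aut d') (\<eta> \<circ> e) \<phi>"
  using sat_transfer[OF assms, of \<phi>] sat_transfer[OF assms, of "Neg \<phi>"] by auto

theorem theorem12p6: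
  fixes A B C :: "pow_fin set"
  assumes "elementary_substructure A UNIV \<sigma>"
    and "elementary_substructure B UNIV \<sigma>"
    and "elementary_substructure C UNIV (inv \<sigma>)"
  shows "(\<forall>\<eta>. dyn_embedding A \<sigma> B \<sigma> \<eta> \<longrightarrow> elementary_embedding A \<sigma> B \<sigma> \<eta>)
    \<and> (\<forall>\<eta>. dyn_embedding A \<sigma> UNIV (inv \<sigma>) \<eta> \<longrightarrow>
            elementary_embedding A \<sigma> (UNIV :: pow_fin set) (inv \<sigma>) \<eta>)
    \<and> (\<forall>\<eta>. dyn_embedding C (inv \<sigma>) UNIV \<sigma> \<eta> \<longrightarrow>
            elementary_embedding C (inv \<sigma>) (UNIV :: pow_fin set) \<sigma> \<eta>)"
proof (intro conjI allI impI)
  have dir: "\<sigma> = dir_aut True" "inv \<sigma> = dir_aut False" by (simp_all add: dir_aut_def)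
  note A = assms(1)[unfolded dir(1)] and C = assms(3)[unfolded dir(2)]
  show "elementary_embedding A \<sigma> UNIV (inv \<sigma>) \<eta>" if "dyn_embedding A \<sigma> UNIV (inv \<sigma>) \<eta>" for \<eta>
    using that sat_transfer_iff[OF A, of False \<eta>]
    by (simp add: elementary_embedding_def dir[symmetric])
  show "elementary_embedding C (inv \<sigma>) UNIV \<sigma> \<eta>" if "dyn_embedding C (inv \<sigma>) UNIV \<sigma> \<eta>" for \<eta>
    using that sat_transfer_iff[OF C, of True \<eta>]
    by (simp add: elementary_embedding_def dir[symmetric])
  show "elementary_embedding A \<sigma> B \<sigma> \<eta>" if \<eta>: "dyn_embedding A \<sigma> B \<sigma> \<eta>" for \<eta>
    unfolding elementary_embedding_def
  proof (intro conjI allI impI \<eta>)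
    fix \<phi> and e :: "nat \<Rightarrow> pow_fin"
    assume e: "range e \<subseteq> A"
    \<comment> \<open>Part (i) passes through the full algebra: truth moves from \<open>A\<close> to
      it along \<eta>, and then down to \<open>B\<close> because the inclusion of \<open>B\<close>
      is elementary.\<close>
    have "dyn_embedding A \<sigma> UNIV \<sigma> \<eta>"
      using \<eta> dyn_system_\<sigma> by (auto simp: dyn_embedding_def boolean_hom_def)
    then have "sat A \<sigma> e \<phi> \<longleftrightarrow> sat UNIV \<sigma> (\<eta> \<circ> e) \<phi>"
      using sat_transfer_iff[OF A, of True \<eta> e \<phi>] e by (simp add: dir[symmetric])
    moreover have "range (\<eta> \<circ> e) \<subseteq> B"
      using \<eta> e by (auto simp: dyn_embedding_def boolean_hom_def)
    ultimately show "sat A \<sigma> e \<phi> \<longleftrightarrow> sat B \<sigma> (\<eta> \<circ> e) \<phi>"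
      using assms(2) by (simp add: elementary_substructure_def elementary_embedding_def)
  qed
qed

end
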